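(* For all $TCCS^m$ processes $P$ and $Q$: $P\approx_{\mathsf{Eq}}Q$ if and only if $\mathcal L_{\mathsf{Eq}}(P)=\mathcal L_{\mathsf{Eq}}(Q)$.
   Context: LANGUAGE. $\mathsf{Act}$ is an infinite set of actions with CCS complementation ($\bar{\bar a}=a$); $\tau\notin\mathsf{Act}$; $\mu$ ranges over $\mathsf{Act}\cup\{\tau\}$. Transaction names: $\mathsf{TrN}=\mathsf{inTrN}\uplus\mathsf{exTrN}$ (internal and external names, both infinite). Terms: $P,Q::=\sum_{i\in J}\mu_i.P_i$ ($J$ countable; $\mathbf 0$ is the empty sum) $\mid P\mid Q\mid\nu a.P\mid X\mid\mathrm{rec}X.P\mid[\![P\triangleright_kQ]\!]$ (running transaction named $k$) $\mid\mathrm{co}\mid[\![P\blacktriangleright Q]\!]$ (dormant transaction). $ftn(o)$ is the set of transaction names in $o$; $o\,\sharp\,o'$ means no transaction name of $o$ occurs in $o'$. A process is a well-formed term: (1) it is closed (no free process variables); (2) $ftn$ of it is finite; and for all subterms $[\![P_1\triangleright_kP_1']\!]$, $[\![P_2\blacktriangleright P_2']\!]$, $\sum\mu_i.Q_i$, $\mathrm{rec}X.R$: (3) $P_1,P_1',P_2,P_2',Q_i,R$ contain no transaction names; (4) $P_1,P_2,Q_i$ contain no dormant transactions; (5) $P_1,P_2$ are closed. PROCESS TRANSITIONS. $P\xrightarrow{\alpha}_\sigma Q$ with $\alpha\in\{a,\tau,k(\tau),k(a)\}$ and $\sigma$ a name substitution $\tilde k\mapsto l$ (domain the finite tuple $\tilde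 k$, possibly empty, range $\{l\}$; $\varepsilon$ alone is the empty substitution). Rules (symmetric ones omitted): - $\sum\mu_i.P_i\xrightarrow{\mu_j}_\varepsilon P_j$; - if $P\xrightarrow{a}_\varepsilon P'$ and $Q\xrightarrow{\bar a}_\varepsilon Q'$ then $P\mid Q\xrightarrow{\tau}_\varepsilon P'\mid Q'$; - $\mathrm{rec}X.P\xrightarrow{\tau}_\varepsilon P[\mathrm{rec}X.P/X]$; - if $\mu_j=a$ then $\sum\mu_i.P_i\xrightarrow{k(a)}_{\varepsilon\mapsto k}[\![P_j\mid\mathrm{co}\triangleright_k\sum\mu_i.P_i]\!]$; - if $P\xrightarrow{\mu}_\varepsilon P'$ and $k\,\sharp\,l$ then $[\![P\triangleright_lQ]\!]\xrightarrow{k(\mu)}_{l\mapsto k}[\![P'\triangleright_kQ]\!]$; - if $P\xrightarrow{k(a)}_{\sigma_1}P'$, $Q\xrightarrow{k(\bar a)}_{\sigma_2}Q'$, $\sigma_i=\tilde l_i\mapsto k$, then $P\mid Q\xrightarrow{k(\tau)}_{(\tilde l_1,\tilde l_2)\mapsto k}P'\sigma_2\mid Q'\sigma_1$; - if $P\xrightarrow{\alpha}_\sigma P'$ and $range(\sigma)\,\sharp\,Q$ then $P\mid Q\xrightarrow{\alpha}_\sigma P'\mid Q\sigma$; - if $P\xrightarrow{\alpha}_\sigma P'$ and $a$ does not occur in $\alpha$ then $\nu a.P\xrightarrow{\alpha}_\sigma\nu a.P'$. Reconfiguration transitions $P\xrightarrow{\beta}Q$, $\beta\in\{\mathrm{co}\,k,\mathrm{ab}\,k,\mathrm{new}\,k\}$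 (symmetric rules omitted): - if $P\equiv\mathrm{co}\mid P''$ for some $P''$ and $P\rightsquigarrow_{\mathrm{co}}P'$ then $[\![P\triangleright_kQ]\!]\xrightarrow{\mathrm{co}\,k}P'$; - $[\![P\blacktriangleright Q]\!]\xrightarrow{\mathrm{new}\,k}[\![P\triangleright_kQ]\!]$; - $[\![P\triangleright_kQ]\!]\xrightarrow{\mathrm{ab}\,k}Q$; - for $\beta=\mathrm{co}\,k$ or $\mathrm{ab}\,k$: if $P\xrightarrow{\beta}P'$ and $Q\xrightarrow{\beta}Q'$ then $P\mid Q\xrightarrow{\beta}P'\mid Q'$; - if $P\xrightarrow{\beta}P'$ and $\beta\,\sharp\,Q$ then $P\mid Q\xrightarrow{\beta}P'\mid Q$; - if $P\xrightarrow{\beta}P'$ then $\nu a.P\xrightarrow{\beta}\nu a.P'$. Here $\equiv$ is standard CCS structural equivalence extended to transactions, and $\rightsquigarrow_{\mathrm{co}}$ is given by: $\mathrm{co}\rightsquigarrow_{\mathrm{co}}\mathbf 0$; sums, variables, $\mathrm{rec}X.P$ and $[\![P\blacktriangleright Q]\!]$ are related to themselves; it is compatible with $\nu a.-$ and $-\mid-$. EXTENDED CONFIGURATIONS. $I$ is a countable index set. An extended configuration is $\langle E;H\bullet P\rangle$ with $P$ a process, $E$ an equivalence relation over a finite subset of $\mathsf{TrN}$, and $H$ a finite partial function from $I$ to $\{k(a),k(\mathrm{ab}),k(\mathrm{co})\mid k\in\mathsf{exTrN},a\in\mathsf{Act}\}$. Let $H^{\mathrm{trn}}(i)$ be the name used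 in $H(i)$, $H^{\mathrm{trn}}$ the set of all these, and $\mathrm{Hasco}(H)=\{k\mid\exists i.\,H(i)=k(\mathrm{co})\}$. It is required that: (i) $H^{\mathrm{trn}}(i)=H^{\mathrm{trn}}(j)$ implies $i=j$; (ii) for $k\in\mathsf{exTrN}$, $k\,E\,k$ iff $k\in H^{\mathrm{trn}}$, and $k\,E\,k'$ implies ($k\in\mathrm{Hasco}(H)$ iff $k'\in\mathrm{Hasco}(H)$); (iii) $ftn(P)\cap\mathrm{Hasco}(H)=\emptyset$; (iv) $k\,E\,k'$ and $k,k'\in ftn(P)$ imply $k=k'$. Convention: external names of a configuration are those in its history, i.e. $ftn(P)\cap\mathsf{exTrN}\subseteq H^{\mathrm{trn}}$; in particular a process $P$ viewed as $\langle\emptyset;\varepsilon\bullet P\rangle$ ($\varepsilon$ the empty history) has $ftn(P)\subseteq\mathsf{inTrN}$. "$H,k(a)$" denotes $H$ extended at a new index. For $\sigma=\tilde k\mapsto l$, $\sigma(E)$ is the smallest equivalence relation $F\supseteq E$ with $l\,F\,l$ and $k\,F\,l$ for all $k\in dom(\sigma)$. $(E;H)\setminus_{\mathrm{co}}k$ (resp. $\setminus_{\mathrm{ab}}k$) keeps $E$ and, for every $k'\,E\,k$, changes each $k'(a)$ in $H$ to $k'(\mathrm{co})$ (resp. $k'(\mathrm{ab})$). With $\Delta=E;H$, the extended transitions (labels $\zeta\in\{\tau,k(a)\}$) between extended configurations are: - $\langle\Delta\bullet P\rangle\xrightarrow{\tau}_e\langle\Delta\bullet Q\rangle$ if $P\xrightarrow{\tau}_\varepsilon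 Q$; - $\xrightarrow{\tau}_e\langle\sigma(E);H\bullet Q\rangle$ if $P\xrightarrow{k(\tau)}_\sigma Q$, $k\,\sharp\,E,H$, $k\in\mathsf{inTrN}$; - $\xrightarrow{\tau}_e\langle\Delta\bullet Q\rangle$ if $P\xrightarrow{\mathrm{new}\,k}Q$, $k\,\sharp\,\Delta$, $k\in\mathsf{inTrN}$; - $\xrightarrow{\tau}_e\langle\Delta\setminus_{\mathrm{co}}k\bullet Q\rangle$ if $P\xrightarrow{\mathrm{co}\,k}Q$; - $\xrightarrow{\tau}_e\langle\Delta\setminus_{\mathrm{ab}}k\bullet Q\rangle$ if $P\xrightarrow{\mathrm{ab}\,k}Q$; - $\xrightarrow{k(a)}_e\langle\sigma(E);H,k(a)\bullet Q\rangle$ if $P\xrightarrow{k(a)}_\sigma Q$, $k\,\sharp\,E,H$, $k\in\mathsf{exTrN}$; - $\xrightarrow{k(a)}_e\langle E,(k,k);H,k(\mathrm{ab})\bullet P\rangle$ if $k\,\sharp\,E,H,P$, $k\in\mathsf{exTrN}$. $\stackrel{\tau}{\Rightarrow}_e$ is $(\xrightarrow{\tau}_e)^*$ and $\stackrel{\zeta}{\Rightarrow}_e$ is $\stackrel{\tau}{\Rightarrow}_e\xrightarrow{\zeta}_e\stackrel{\tau}{\Rightarrow}_e$ otherwise. $\mathsf{Eq}$-BISIMULATION. For $\mathcal C=\langle E;H\bullet P\rangle$ and $k,k'\in\mathsf{exTrN}$ write $\mathcal C\models k=_{\mathrm{co}}k'$ if $k,k'\in\mathrm{Hasco}(H)$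 and $k\,E\,k'$. $\mathcal C_1\,\mathsf{Eq}\,\mathcal C_2$ means that for all $k,k'\in\mathsf{exTrN}$: $\mathcal C_1\models k=_{\mathrm{co}}k'$ iff $\mathcal C_2\models k=_{\mathrm{co}}k'$. A relation $\mathcal R$ on extended configurations is an $\mathsf{Eq}$-bisimulation if $\mathcal C_1\mathcal R\mathcal C_2$ implies: $\mathcal C_1\,\mathsf{Eq}\,\mathcal C_2$; and if $\mathcal C_1\stackrel{\zeta}{\Rightarrow}_e\mathcal C_1'$ with $\zeta\,\sharp\,\mathcal C_2$ then $\mathcal C_2\stackrel{\zeta}{\Rightarrow}_e\mathcal C_2'$ for some $\mathcal C_2'$ with $\mathcal C_1'\mathcal R\mathcal C_2'$; and conversely. $\approx_{\mathsf{Eq}}$ is the largest one; $P\approx_{\mathsf{Eq}}Q$ means $\langle\emptyset;\varepsilon\bullet P\rangle\approx_{\mathsf{Eq}}\langle\emptyset;\varepsilon\bullet Q\rangle$. LOGIC $\mathcal L_{\mathsf{Eq}}$. $\mathsf{Var}$ is a countable set of variables disjoint from $\mathsf{exTrN}$. Formulae: $\phi::=\langle\tau\rangle\phi\mid\langle x(a)\rangle\phi\mid\neg\phi\mid\bigwedge_{i\in K}\phi_i$ ($K$ an arbitrary index set) $\mid v_1=_{\mathrm{co}}v_2$, with $x\in\mathsf{Var}$, $a\in\mathsf{Act}$, $v_i\in\mathsf{exTrN}\cup\mathsf{Var}$; $\langle x(a)\rangle\phi$ binds $x$ in $\phi$; closed formulae have no free variables. Satisfaction for closed formulae: for $\mathcal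 C=\langle E;H\bullet P\rangle$ and $k,k'\in\mathsf{exTrN}$, $\mathcal C\models k=_{\mathrm{co}}k'$ iff $k,k'\in\mathrm{Hasco}(H)$ and $k\,E\,k'$; $\mathcal C\models\langle\tau\rangle\phi$ iff $\mathcal C\stackrel{\tau}{\Rightarrow}_e\mathcal C'$ with $\mathcal C'\models\phi$ for some $\mathcal C'$; $\mathcal C\models\langle x(a)\rangle\phi$ iff there is a cofinite $N\subseteq\mathsf{exTrN}$ such that for all $l\in N$ there is $\mathcal C'$ with $\mathcal C\stackrel{l(a)}{\Rightarrow}_e\mathcal C'$ and $\mathcal C'\models\phi[l/x]$; conjunction and negation are standard. $\mathcal L_{\mathsf{Eq}}(P)$ is the set of closed $\phi$ with $\langle\emptyset;\varepsilon\bullet P\rangle\models\phi$. *)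

theory Defs
  imports Main "HOL-Library.Infinite_Typeclass"
begin

section \<open>Actions, names and terms\<close>

text \<open>
  The actions are the names and co-names over a set of channels. Inside terms a channel is either
  a free one or bound by a restriction. Terms are taken up to alpha-conversion: restrictions and
  recursions bind de Bruijn indices, in two separate index spaces. Thus \<open>Res P\<close> binds both
  \<open>Name (Bound 0)\<close> and \<open>Coname (Bound 0)\<close> in \<open>P\<close>, as \<open>\<nu>a\<close> binds an action and its complement.
\<close>

datatype 'c act = Name 'c | Coname 'c

primrec bar :: "'c act \<Rightarrow> 'c act" where
  "bar (Name c) = Coname c"
| "bar (Coname c) = Name c"

datatype 'n chan = Free 'n | Bound nat

primrec ren_chan :: "(nat \<Rightarrow> nat) \<Rightarrow> 'n chan \<Rightarrow> 'n chan" where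
  "ren_chan r (Free n) = Free n"
| "ren_chan r (Bound i) = Bound (r i)"

datatype 'c pre = Tau | Act "'c act"

datatype ('m, 'e) trn = In 'm | Ex 'e

text \<open>
  A sum is a family of prefixed terms indexed by a subset of \<open>nat\<close>, namely the domain of a partial
  function. \<open>Run P k Q\<close> and \<open>Dorm P Q\<close> are the running transaction named \<open>k\<close> and the dormant one.
\<close>

datatype (dead 'n, ftn: 't) tm =
    Sum "nat \<rightharpoonup> 'n chan pre \<times> ('n, 't) tm"
  | Par "('n, 't) tm" "('n, 't) tm"
  | Res "('n, 't) tm"
  | Var nat
  | Rec "('n, 't) tm"
  | Run "('n, 't) tm" 't "('n, 't) tm"
  | Co
  | Dorm "('n, 't) tm" "('n, 't) tm"
  for map: map_trn

abbreviation Zero :: "('n, 't) tm" where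
  "Zero \<equiv> Sum Map.empty"

text \<open>\<open>under r\<close> is the renaming of indices \<open>r\<close> taken below one further binder.\<close>

definition under :: "(nat \<Rightarrow> nat) \<Rightarrow> nat \<Rightarrow> nat" where
  "under r i = (case i of 0 \<Rightarrow> 0 | Suc j \<Rightarrow> Suc (r j))"

primrec ren_res :: "(nat \<Rightarrow> nat) \<Rightarrow> ('n, 't) tm \<Rightarrow> ('n, 't) tm" where
  "ren_res r (Sum f) =
     Sum (\<lambda>i. map_option (map_prod (map_pre (ren_chan r)) (ren_res r)) (f i))"
| "ren_res r (Par P Q) = Par (ren_res r P) (ren_res r Q)"
| "ren_res r (Res P) = Res (ren_res (under r) P)"
| "ren_res r (Var n) = Var n"
| "ren_res r (Rec P) = Rec (ren_res r P)"
| "ren_res r (Run P k Q) = Run (ren_res r P) k (ren_res r Q)"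
| "ren_res r Co = Co"
| "ren_res r (Dorm P Q) = Dorm (ren_res r P) (ren_res r Q)"

primrec ren_var :: "(nat \<Rightarrow> nat) \<Rightarrow> ('n, 't) tm \<Rightarrow> ('n, 't) tm" where
  "ren_var r (Sum f) = Sum (\<lambda>i. map_option (map_prod id (ren_var r)) (f i))"
| "ren_var r (Par P Q) = Par (ren_var r P) (ren_var r Q)"
| "ren_var r (Res P) = Res (ren_var r P)"
| "ren_var r (Var n) = Var (r n)"
| "ren_var r (Rec P) = Rec (ren_var (under r) P)"
| "ren_var r (Run P k Q) = Run (ren_var r P) k (ren_var r Q)"
| "ren_var r Co = Co"
| "ren_var r (Dorm P Q) = Dorm (ren_var r P) (ren_var r Q)"

text \<open>
  \<open>subst n R P\<close> replaces the process variable \<open>n\<close> by \<open>R\<close>, avoiding capture, and lowers the variables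
  above \<open>n\<close>. Hence \<open>subst 0 (Rec P) P\<close> is the unfolding of \<open>Rec P\<close>.
\<close>

primrec subst :: "nat \<Rightarrow> ('n, 't) tm \<Rightarrow> ('n, 't) tm \<Rightarrow> ('n, 't) tm" where
  "subst n R (Sum f) = Sum (\<lambda>i. map_option (map_prod id (subst n R)) (f i))"
| "subst n R (Par P Q) = Par (subst n R P) (subst n R Q)"
| "subst n R (Res P) = Res (subst n (ren_res Suc R) P)"
| "subst n R (Var m) = (if m = n then R else if n < m then Var (m - 1) else Var m)"
| "subst n R (Rec P) = Rec (subst (Suc n) (ren_var Suc R) P)"
| "subst n R (Run P k Q) = Run (subst n R P) k (subst n R Q)"
| "subst n R Co = Co"
| "subst n R (Dorm P Q) = Dorm (subst n R P) (subst n R Q)"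


section \<open>Processes\<close>

primrec fv :: "('n, 't) tm \<Rightarrow> nat set" where
  "fv (Sum f) = (\<Union>(\<mu>, V) \<in> ran (\<lambda>i. map_option (map_prod id fv) (f i)). V)"
| "fv (Par P Q) = fv P \<union> fv Q"
| "fv (Res P) = fv P"
| "fv (Var n) = {n}"
| "fv (Rec P) = {n. Suc n \<in> fv P}"
| "fv (Run P k Q) = fv P \<union> fv Q"
| "fv Co = {}"
| "fv (Dorm P Q) = fv P \<union> fv Q"

text \<open>Restriction indices not bound by any enclosing \<open>Res\<close>.\<close>

primrec dangling :: "('n, 't) tm \<Rightarrow> nat set" where
  "dangling (Sum f) =
     (\<Union>(\<mu>, D) \<in> ran (\<lambda>i. map_option (map_prod id dangling) (f i)).
        {i. Bound i \<in> set_pre \<mu>} \<union> D)"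
| "dangling (Par P Q) = dangling P \<union> dangling Q"
| "dangling (Res P) = {i. Suc i \<in> dangling P}"
| "dangling (Var n) = {}"
| "dangling (Rec P) = dangling P"
| "dangling (Run P k Q) = dangling P \<union> dangling Q"
| "dangling Co = {}"
| "dangling (Dorm P Q) = dangling P \<union> dangling Q"

inductive subterm :: "('n, 't) tm \<Rightarrow> ('n, 't) tm \<Rightarrow> bool" where
  "subterm P P"
| "f i = Some (\<mu>, P) \<Longrightarrow> subterm R P \<Longrightarrow> subterm R (Sum f)"
| "subterm R P \<Longrightarrow> subterm R (Par P Q)"
| "subterm R Q \<Longrightarrow> subterm R (Par P Q)"
| "subterm R P \<Longrightarrow> subterm R (Res P)"
| "subterm R P \<Longrightarrow> subterm R (Rec P)"
| "subterm R P \<Longrightarrow> subterm R (Run P k Q)"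
| "subterm R Q \<Longrightarrow> subterm R (Run P k Q)"
| "subterm R P \<Longrightarrow> subterm R (Dorm P Q)"
| "subterm R Q \<Longrightarrow> subterm R (Dorm P Q)"

definition no_dormant :: "('n, 't) tm \<Rightarrow> bool" where
  "no_dormant P \<longleftrightarrow> (\<nexists>R S. subterm (Dorm R S) P)"

text \<open>
  The condition on \<open>dangling\<close> has no counterpart with named binders: it says that every restriction
  index of \<open>P\<close> belongs to some \<open>Res\<close>.
\<close>

definition process :: "('n, 't) tm \<Rightarrow> bool" where
  "process P \<longleftrightarrow>
     dangling P = {} \<and> fv P = {} \<and> finite (ftn P) \<and>
     (\<forall>P1 k P1'. subterm (Run P1 k P1') P \<longrightarrow>
        ftn P1 = {} \<and> ftn P1' = {} \<and> no_dormant P1 \<and> fv P1 = {}) \<and>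
     (\<forall>P2 P2'. subterm (Dorm P2 P2') P \<longrightarrow>
        ftn P2 = {} \<and> ftn P2' = {} \<and> no_dormant P2 \<and> fv P2 = {}) \<and>
     (\<forall>f i \<mu> Q. subterm (Sum f) P \<longrightarrow> f i = Some (\<mu>, Q) \<longrightarrow> ftn Q = {} \<and> no_dormant Q) \<and>
     (\<forall>R. subterm (Rec R) P \<longrightarrow> ftn R = {})"


section \<open>Transitions of processes\<close>

text \<open>\<open>Maps ks l\<close> is the name substitution sending every name of the tuple \<open>ks\<close> to \<open>l\<close>. Its range is
  \<open>{l}\<close> even if \<open>ks\<close> is empty, which distinguishes \<open>Maps [] l\<close> from \<open>Eps\<close>.\<close>

datatype 't nsub = Eps | Maps "'t list" 't

primrec ndom :: "'t nsub \<Rightarrow> 't set" where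
  "ndom Eps = {}"
| "ndom (Maps ks l) = set ks"

primrec nrange :: "'t nsub \<Rightarrow> 't set" where
  "nrange Eps = {}"
| "nrange (Maps ks l) = {l}"

primrec napp :: "'t nsub \<Rightarrow> 't \<Rightarrow> 't" where
  "napp Eps k = k"
| "napp (Maps ks l) k = (if k \<in> set ks then l else k)"

abbreviation tapp :: "('n, 't) tm \<Rightarrow> 't nsub \<Rightarrow> ('n, 't) tm" where
  "tapp P \<sigma> \<equiv> map_trn (napp \<sigma>) P"

text \<open>\<open>Plain \<mu>\<close> is the label \<open>\<mu>\<close> and \<open>At k \<mu>\<close> is the label \<open>k(\<mu>)\<close>.\<close>

datatype ('c, 't) lab = Plain "'c pre" | At 't "'c pre"

text \<open>
  In the rule \<open>res\<close>, a label of the form \<open>map_lab (ren_chan Suc) id \<alpha>\<close> is one in which the channel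
  bound by the restriction does not occur, and \<open>\<alpha>\<close> is the same label seen from outside.
\<close>

inductive ptrans ::
  "('n, 't) tm \<Rightarrow> ('n chan, 't) lab \<Rightarrow> 't nsub \<Rightarrow> ('n, 't) tm \<Rightarrow> bool" where
  sum: "f j = Some (\<mu>, P) \<Longrightarrow> ptrans (Sum f) (Plain \<mu>) Eps P"
| comm: "ptrans P (Plain (Act a)) Eps P' \<Longrightarrow> ptrans Q (Plain (Act (bar a))) Eps Q' \<Longrightarrow>
    ptrans (Par P Q) (Plain Tau) Eps (Par P' Q')"
| unfold: "ptrans (Rec P) (Plain Tau) Eps (subst 0 (Rec P) P)"
| tr_sum: "f j = Some (Act a, P) \<Longrightarrow>
    ptrans (Sum f) (At k (Act a)) (Maps [] k) (Run (Par P Co) k (Sum f))"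
| tr_run: "ptrans P (Plain \<mu>) Eps P' \<Longrightarrow> k \<noteq> l \<Longrightarrow>
    ptrans (Run P l Q) (At k \<mu>) (Maps [l] k) (Run P' k Q)"
| tr_comm: "ptrans P (At k (Act a)) (Maps ls1 k) P' \<Longrightarrow>
    ptrans Q (At k (Act (bar a))) (Maps ls2 k) Q' \<Longrightarrow>
    ptrans (Par P Q) (At k Tau) (Maps (ls1 @ ls2) k)
      (Par (tapp P' (Maps ls2 k)) (tapp Q' (Maps ls1 k)))"
| par_left: "ptrans P \<alpha> \<sigma> P' \<Longrightarrow> nrange \<sigma> \<inter> ftn Q = {} \<Longrightarrow>
    ptrans (Par P Q) \<alpha> \<sigma> (Par P' (tapp Q \<sigma>))"
| par_right: "ptrans Q \<alpha> \<sigma> Q' \<Longrightarrow> nrange \<sigma> \<inter> ftn P = {} \<Longrightarrow>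
    ptrans (Par P Q) \<alpha> \<sigma> (Par (tapp P \<sigma>) Q')"
| res: "ptrans P (map_lab (ren_chan Suc) id \<alpha>) \<sigma> P' \<Longrightarrow> ptrans (Res P) \<alpha> \<sigma> (Res P')"

text \<open>Alpha-conversion is not a rule of structural equivalence, since terms are already taken up to it.\<close>

inductive struct_eq :: "('n, 't) tm \<Rightarrow> ('n, 't) tm \<Rightarrow> bool"  (infix \<open>\<equiv>\<^sub>s\<close> 50) where
  se_refl: "P \<equiv>\<^sub>s P"
| se_sym: "P \<equiv>\<^sub>s Q \<Longrightarrow> Q \<equiv>\<^sub>s P"
| se_trans: "P \<equiv>\<^sub>s Q \<Longrightarrow> Q \<equiv>\<^sub>s R \<Longrightarrow> P \<equiv>\<^sub>s R"
| se_par_comm: "Par P Q \<equiv>\<^sub>s Par Q P"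
| se_par_assoc: "Par (Par P Q) R \<equiv>\<^sub>s Par P (Par Q R)"
| se_par_nil: "Par P Zero \<equiv>\<^sub>s P"
| se_sum_reindex: "bij_betw \<pi> (dom f) (dom g) \<Longrightarrow> \<forall>i\<in>dom f. g (\<pi> i) = f i \<Longrightarrow> Sum f \<equiv>\<^sub>s Sum g"
| se_res_nil: "Res Zero \<equiv>\<^sub>s Zero"
| se_res_swap: "Res (Res P) \<equiv>\<^sub>s Res (Res (ren_res (id(0 := 1, 1 := 0)) P))"
| se_extrude: "Par (Res P) Q \<equiv>\<^sub>s Res (Par P (ren_res Suc Q))"
| se_sum_cong: "\<forall>i. rel_option (rel_prod (=) (\<equiv>\<^sub>s)) (f i) (g i) \<Longrightarrow> Sum f \<equiv>\<^sub>s Sum g"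
| se_par_cong: "P \<equiv>\<^sub>s P' \<Longrightarrow> Q \<equiv>\<^sub>s Q' \<Longrightarrow> Par P Q \<equiv>\<^sub>s Par P' Q'"
| se_res_cong: "P \<equiv>\<^sub>s P' \<Longrightarrow> Res P \<equiv>\<^sub>s Res P'"
| se_rec_cong: "P \<equiv>\<^sub>s P' \<Longrightarrow> Rec P \<equiv>\<^sub>s Rec P'"
| se_run_cong: "P \<equiv>\<^sub>s P' \<Longrightarrow> Q \<equiv>\<^sub>s Q' \<Longrightarrow> Run P k Q \<equiv>\<^sub>s Run P' k Q'"
| se_dorm_cong: "P \<equiv>\<^sub>s P' \<Longrightarrow> Q \<equiv>\<^sub>s Q' \<Longrightarrow> Dorm P Q \<equiv>\<^sub>s Dorm P' Q'"

inductive co_erase :: "('n, 't) tm \<Rightarrow> ('n, 't) tm \<Rightarrow> bool"  (infix \<open>\<leadsto>\<^sub>c\<^sub>o\<close> 50) where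
  "Co \<leadsto>\<^sub>c\<^sub>o Zero"
| "Sum f \<leadsto>\<^sub>c\<^sub>o Sum f"
| "Var n \<leadsto>\<^sub>c\<^sub>o Var n"
| "Rec P \<leadsto>\<^sub>c\<^sub>o Rec P"
| "Dorm P Q \<leadsto>\<^sub>c\<^sub>o Dorm P Q"
| "P \<leadsto>\<^sub>c\<^sub>o P' \<Longrightarrow> Res P \<leadsto>\<^sub>c\<^sub>o Res P'"
| "P \<leadsto>\<^sub>c\<^sub>o P' \<Longrightarrow> Q \<leadsto>\<^sub>c\<^sub>o Q' \<Longrightarrow> Par P Q \<leadsto>\<^sub>c\<^sub>o Par P' Q'"

datatype 't rlab = Commit 't | Abort 't | New 't

inductive reconf :: "('n, 't) tm \<Rightarrow> 't rlab \<Rightarrow> ('n, 't) tm \<Rightarrow> bool" where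
  co: "P \<equiv>\<^sub>s Par Co P'' \<Longrightarrow> P \<leadsto>\<^sub>c\<^sub>o P' \<Longrightarrow> reconf (Run P k Q) (Commit k) P'"
| new: "reconf (Dorm P Q) (New k) (Run P k Q)"
| ab: "reconf (Run P k Q) (Abort k) Q"
| par_both: "\<beta> = Commit k \<or> \<beta> = Abort k \<Longrightarrow> reconf P \<beta> P' \<Longrightarrow> reconf Q \<beta> Q' \<Longrightarrow>
    reconf (Par P Q) \<beta> (Par P' Q')"
| par_left: "reconf P \<beta> P' \<Longrightarrow> set_rlab \<beta> \<inter> ftn Q = {} \<Longrightarrow> reconf (Par P Q) \<beta> (Par P' Q)"
| par_right: "reconf Q \<beta> Q' \<Longrightarrow> set_rlab \<beta> \<inter> ftn P = {} \<Longrightarrow> reconf (Par P Q) \<beta> (Par P Q')"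
| res: "reconf P \<beta> P' \<Longrightarrow> reconf (Res P) \<beta> (Res P')"


section \<open>Extended configurations\<close>

datatype ('n, 'e) hentry = HAct (hname: 'e) "'n act" | HAb (hname: 'e) | HCo (hname: 'e)

type_synonym ('n, 'e) hist = "nat \<rightharpoonup> ('n, 'e) hentry"

type_synonym 't eqrel = "('t \<times> 't) set"

datatype ('n, 'm, 'e) conf =
  Conf (eqv: "('m, 'e) trn eqrel") (hist: "('n, 'e) hist") (prc: "('n, ('m, 'e) trn) tm")

definition htrn :: "('n, 'e) hist \<Rightarrow> 'e set" where
  "htrn H = hname ` ran H"

definition hasco :: "('n, 'e) hist \<Rightarrow> 'e set" where
  "hasco H = {k. \<exists>i. H i = Some (HCo k)}"

text \<open>The last conjunct is the convention that the external names of a process are recorded in the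
  history.\<close>

definition config :: "('n, 'm, 'e) conf \<Rightarrow> bool" where
  "config C \<longleftrightarrow> (case C of Conf E H P \<Rightarrow>
     process P \<and> (\<exists>A. finite A \<and> equiv A E) \<and> finite (dom H) \<and>
     (\<forall>i j h h'. H i = Some h \<longrightarrow> H j = Some h' \<longrightarrow> hname h = hname h' \<longrightarrow> i = j) \<and>
     (\<forall>k. (Ex k, Ex k) \<in> E \<longleftrightarrow> k \<in> htrn H) \<and>
     (\<forall>k k'. (Ex k, Ex k') \<in> E \<longrightarrow> (k \<in> hasco H \<longleftrightarrow> k' \<in> hasco H)) \<and>
     ftn P \<inter> Ex ` hasco H = {} \<and>
     (\<forall>k k'. (k, k') \<in> E \<longrightarrow> k \<in> ftn P \<longrightarrow> k' \<in> ftn P \<longrightarrow> k = k') \<and>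
     ftn P \<inter> range Ex \<subseteq> Ex ` htrn H)"

definition names_env :: "('m, 'e) trn eqrel \<Rightarrow> ('n, 'e) hist \<Rightarrow> ('m, 'e) trn set" where
  "names_env E H = Field E \<union> Ex ` htrn H"

definition names_conf :: "('n, 'm, 'e) conf \<Rightarrow> ('m, 'e) trn set" where
  "names_conf C = names_env (eqv C) (hist C) \<union> ftn (prc C)"

text \<open>The least equivalence relation, over whichever set of names, with the required pairs.\<close>

definition merge :: "'t nsub \<Rightarrow> 't eqrel \<Rightarrow> 't eqrel" where
  "merge \<sigma> E = \<Inter>{F. (\<exists>A. equiv A F) \<and> E \<subseteq> F \<and>
     (\<forall>l\<in>nrange \<sigma>. (l, l) \<in> F \<and> (\<forall>k\<in>ndom \<sigma>. (k, l) \<in> F))}"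

definition mark :: "('e \<Rightarrow> ('n, 'e) hentry) \<Rightarrow> ('m, 'e) trn eqrel \<Rightarrow> ('m, 'e) trn \<Rightarrow>
    ('n, 'e) hentry \<Rightarrow> ('n, 'e) hentry" where
  "mark c E k h = (case h of HAct k' a \<Rightarrow> if (Ex k', k) \<in> E then c k' else h | _ \<Rightarrow> h)"

definition mark_co :: "('m, 'e) trn eqrel \<Rightarrow> ('m, 'e) trn \<Rightarrow> ('n, 'e) hist \<Rightarrow> ('n, 'e) hist" where
  "mark_co E k H = (\<lambda>i. map_option (mark HCo E k) (H i))"

definition mark_ab :: "('m, 'e) trn eqrel \<Rightarrow> ('m, 'e) trn \<Rightarrow> ('n, 'e) hist \<Rightarrow> ('n, 'e) hist" where
  "mark_ab E k H = (\<lambda>i. map_option (mark HAb E k) (H i))"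

datatype ('n, 'e) elab = ETau | EAct 'e "'n act"

primrec names_elab :: "('n, 'e) elab \<Rightarrow> ('m, 'e) trn set" where
  "names_elab ETau = {}"
| "names_elab (EAct k a) = {Ex k}"

inductive etrans_rule :: "('n, 'm, 'e) conf \<Rightarrow> ('n, 'e) elab \<Rightarrow> ('n, 'm, 'e) conf \<Rightarrow> bool" where
  "ptrans P (Plain Tau) Eps Q \<Longrightarrow> etrans_rule (Conf E H P) ETau (Conf E H Q)"
| "ptrans P (At k Tau) \<sigma> Q \<Longrightarrow> k \<notin> names_env E H \<Longrightarrow> k \<in> range In \<Longrightarrow>
    etrans_rule (Conf E H P) ETau (Conf (merge \<sigma> E) H Q)"
| "reconf P (New k) Q \<Longrightarrow> k \<notin> names_env E H \<Longrightarrow> k \<in> range In \<Longrightarrow>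
    etrans_rule (Conf E H P) ETau (Conf E H Q)"
| "reconf P (Commit k) Q \<Longrightarrow> etrans_rule (Conf E H P) ETau (Conf E (mark_co E k H) Q)"
| "reconf P (Abort k) Q \<Longrightarrow> etrans_rule (Conf E H P) ETau (Conf E (mark_ab E k H) Q)"
| "ptrans P (At (Ex k) (Act (map_act Free a))) \<sigma> Q \<Longrightarrow> Ex k \<notin> names_env E H \<Longrightarrow> i \<notin> dom H \<Longrightarrow>
    etrans_rule (Conf E H P) (EAct k a) (Conf (merge \<sigma> E) (H(i \<mapsto> HAct k a)) Q)"
| "Ex k \<notin> names_env E H \<union> ftn P \<Longrightarrow> i \<notin> dom H \<Longrightarrow>
    etrans_rule (Conf E H P) (EAct k a) (Conf (insert (Ex k, Ex k) E) (H(i \<mapsto> HAb k)) P)"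

definition etrans :: "('n, 'm, 'e) conf \<Rightarrow> ('n, 'e) elab \<Rightarrow> ('n, 'm, 'e) conf \<Rightarrow> bool" where
  "etrans C \<zeta> C' \<longleftrightarrow> config C \<and> config C' \<and> etrans_rule C \<zeta> C'"

abbreviation weak_tau :: "('n, 'm, 'e) conf \<Rightarrow> ('n, 'm, 'e) conf \<Rightarrow> bool" where
  "weak_tau \<equiv> (\<lambda>C C'. etrans C ETau C')\<^sup>*\<^sup>*"

definition weak :: "('n, 'm, 'e) conf \<Rightarrow> ('n, 'e) elab \<Rightarrow> ('n, 'm, 'e) conf \<Rightarrow> bool" where
  "weak C \<zeta> C' \<longleftrightarrow>
     (if \<zeta> = ETau then weak_tau C C'
      else \<exists>D D'. weak_tau C D \<and> etrans D \<zeta> D' \<and> weak_tau D' C')"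


section \<open>Eq-bisimulation\<close>

definition co_eq :: "('n, 'm, 'e) conf \<Rightarrow> 'e \<Rightarrow> 'e \<Rightarrow> bool" where
  "co_eq C k k' \<longleftrightarrow> k \<in> hasco (hist C) \<and> k' \<in> hasco (hist C) \<and> (Ex k, Ex k') \<in> eqv C"

definition Eq :: "('n, 'm, 'e) conf \<Rightarrow> ('n, 'm, 'e) conf \<Rightarrow> bool" where
  "Eq C1 C2 \<longleftrightarrow> (\<forall>k k'. co_eq C1 k k' \<longleftrightarrow> co_eq C2 k k')"

definition Eq_bisimulation :: "(('n, 'm, 'e) conf \<Rightarrow> ('n, 'm, 'e) conf \<Rightarrow> bool) \<Rightarrow> bool" where
  "Eq_bisimulation R \<longleftrightarrow> (\<forall>C1 C2. R C1 C2 \<longrightarrow>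
     config C1 \<and> config C2 \<and> Eq C1 C2 \<and>
     (\<forall>\<zeta> C1'. weak C1 \<zeta> C1' \<longrightarrow> names_elab \<zeta> \<inter> names_conf C2 = {} \<longrightarrow>
        (\<exists>C2'. weak C2 \<zeta> C2' \<and> R C1' C2')) \<and>
     (\<forall>\<zeta> C2'. weak C2 \<zeta> C2' \<longrightarrow> names_elab \<zeta> \<inter> names_conf C1 = {} \<longrightarrow>
        (\<exists>C1'. weak C1 \<zeta> C1' \<and> R C1' C2')))"

definition conf_bisim :: "('n, 'm, 'e) conf \<Rightarrow> ('n, 'm, 'e) conf \<Rightarrow> bool" where
  "conf_bisim C1 C2 \<longleftrightarrow> (\<exists>R. Eq_bisimulation R \<and> R C1 C2)"

definition init :: "('n, ('m, 'e) trn) tm \<Rightarrow> ('n, 'm, 'e) conf" where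
  "init P = Conf {} Map.empty P"

definition bisim :: "('n, ('m, 'e) trn) tm \<Rightarrow> ('n, ('m, 'e) trn) tm \<Rightarrow> bool"
    (infix \<open>\<approx>\<^sub>E\<^sub>q\<close> 50) where
  "P \<approx>\<^sub>E\<^sub>q Q \<longleftrightarrow> conf_bisim (init P) (init Q)"


section \<open>The logic\<close>

text \<open>
  Logical variables are natural numbers, and an element of \<open>exTrN \<union> Var\<close> is one of \<open>'e + nat\<close>.
  Conjunctions are families indexed by arbitrary subsets of \<open>'i\<close>. No single type can provide all index
  sets, so the index type remains a parameter.
\<close>

datatype ('n, 'e, 'i) form =
    Dia "('n, 'e, 'i) form"
  | DiaAct nat "'n act" "('n, 'e, 'i) form"
  | Neg "('n, 'e, 'i) form"
  | Conj "'i \<rightharpoonup> ('n, 'e, 'i) form"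
  | EqCo "'e + nat" "'e + nat"

primrec free_vars :: "('n, 'e, 'i) form \<Rightarrow> nat set" where
  "free_vars (Dia \<phi>) = free_vars \<phi>"
| "free_vars (DiaAct x a \<phi>) = free_vars \<phi> - {x}"
| "free_vars (Neg \<phi>) = free_vars \<phi>"
| "free_vars (Conj f) = \<Union>(ran (\<lambda>i. map_option free_vars (f i)))"
| "free_vars (EqCo v w) = {x. Inr x = v \<or> Inr x = w}"

text \<open>\<open>fsubst l x \<phi>\<close> is \<open>\<phi>[l/x]\<close>; names are never bound, so nothing can be captured.\<close>

primrec fsubst :: "'e \<Rightarrow> nat \<Rightarrow> ('n, 'e, 'i) form \<Rightarrow> ('n, 'e, 'i) form" where
  "fsubst l x (Dia \<phi>) = Dia (fsubst l x \<phi>)"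
| "fsubst l x (DiaAct y a \<phi>) = DiaAct y a (if y = x then \<phi> else fsubst l x \<phi>)"
| "fsubst l x (Neg \<phi>) = Neg (fsubst l x \<phi>)"
| "fsubst l x (Conj f) = Conj (\<lambda>i. map_option (fsubst l x) (f i))"
| "fsubst l x (EqCo v w) =
     EqCo (if v = Inr x then Inl l else v) (if w = Inr x then Inl l else w)"

text \<open>Satisfaction recurses along the proper subformula order on formulae with variables and names
  erased, which substitution leaves unchanged.\<close>

primrec shape :: "('n, 'e, 'i) form \<Rightarrow> ('n, 'e, 'i) form" where
  "shape (Dia \<phi>) = Dia (shape \<phi>)"
| "shape (DiaAct x a \<phi>) = DiaAct 0 a (shape \<phi>)"
| "shape (Neg \<phi>) = Neg (shape \<phi>)"
| "shape (Conj f) = Conj (\<lambda>i. map_option shape (f i))"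
| "shape (EqCo v w) = EqCo (Inr 0) (Inr 0)"

inductive_set child :: "(('n, 'e, 'i) form \<times> ('n, 'e, 'i) form) set" where
  "(\<phi>, Dia \<phi>) \<in> child"
| "(\<phi>, DiaAct x a \<phi>) \<in> child"
| "(\<phi>, Neg \<phi>) \<in> child"
| "f i = Some \<phi> \<Longrightarrow> (\<phi>, Conj f) \<in> child"

inductive_cases child_cases:
  "(\<psi>, Dia \<phi>) \<in> child" "(\<psi>, DiaAct x a \<phi>) \<in> child" "(\<psi>, Neg \<phi>) \<in> child"
  "(\<psi>, Conj f) \<in> child" "(\<psi>, EqCo v w) \<in> child"

lemma wf_child: "wf child"
proof (rule wfUNIVI)
  fix P :: "('n, 'e, 'i) form \<Rightarrow> bool" and \<phi>
  assume "\<forall>\<phi>. (\<forall>\<psi>. (\<psi>, \<phi>) \<in> child \<longrightarrow> P \<psi>) \<longrightarrow> P \<phi>"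
  then have *: "(\<And>\<psi>. (\<psi>, \<phi>) \<in> child \<Longrightarrow> P \<psi>) \<Longrightarrow> P \<phi>" for \<phi>
    by blast
  show "P \<phi>"
  proof (induction \<phi>)
    case (Conj f)
    show ?case
    proof (rule *)
      fix \<psi> assume "(\<psi>, Conj f) \<in> child"
      then obtain i where "f i = Some \<psi>"
        by (rule child_cases)
      then show "P \<psi>"
        using Conj[of "f i" \<psi>] by (metis option.set_intros rangeI)
    qed
  qed (rule *, erule child_cases; simp)+
qed

lemma shape_fsubst: "shape (fsubst l x \<phi>) = shape \<phi>"
proof (induction \<phi>)
  case (Conj f)
  have "map_option shape (map_option (fsubst l x) (f i)) = map_option shape (f i)" for i
    using Conj[of "f i"] by (cases "f i") (metis option.map(1), metis option.map(2) option.set_intros rangeI)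
  then show ?case by simp
qed auto

function (sequential) sat :: "('n, 'm, 'e) conf \<Rightarrow> ('n, 'e, 'i) form \<Rightarrow> bool" where
  "sat C (Dia \<phi>) \<longleftrightarrow> (\<exists>C'. weak C ETau C' \<and> sat C' \<phi>)"
| "sat C (DiaAct x a \<phi>) \<longleftrightarrow>
     (\<exists>N. finite (- N) \<and> (\<forall>l\<in>N. \<exists>C'. weak C (EAct l a) C' \<and> sat C' (fsubst l x \<phi>)))"
| "sat C (Neg \<phi>) \<longleftrightarrow> \<not> sat C \<phi>"
| "sat C (Conj f) \<longleftrightarrow> (\<forall>\<phi>\<in>ran f. sat C \<phi>)"
| "sat C (EqCo (Inl k) (Inl k')) \<longleftrightarrow> co_eq C k k'"
| "sat C (EqCo _ _) \<longleftrightarrow> False"  \<comment> \<open>not closed\<close>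
  by pat_completeness auto
termination
proof (relation "inv_image child (\<lambda>(C, \<phi>). shape \<phi>)", goal_cases)
  case 1
  show ?case by (rule wf_inv_image[OF wf_child])
next
  case (5 C f \<phi>)
  then obtain i where "f i = Some \<phi>"
    unfolding ran_def by blast
  then show ?case
    by (simp add: child.intros(4)[of _ i])
qed (simp_all add: shape_fsubst child.intros(1-3))

definition L_Eq :: "('n, ('m, 'e) trn) tm \<Rightarrow> ('n, 'e, 'i) form set" where
  "L_Eq P = {\<phi>. free_vars \<phi> = {} \<and> sat (init P) \<phi>}"

end

theory Submission
  imports Defs "HOL-Combinatorics.Transposition"
begin

text \<open>
  Bisimilar configurations satisfy the same closed formulae by induction on the formula: the cofinite
  set of \<open>\<langle>x(a)\<rangle>\<phi>\<close> can be shrunk by the finitely many names of both configurations, and the other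
  names are fresh for both. Conversely, satisfying the same formulae over the recorded external names is
  shown to be a bisimulation. If a step of one configuration to \<open>C'\<close> had no match, each derivative of
  the other would fail some formula satisfied by \<open>C'\<close>, and \<open>C'\<close> would satisfy the conjunction \<open>\<phi>\<close> of
  these formulae. For a \<open>\<tau>\<close>-step \<open>\<langle>\<tau>\<rangle>\<phi>\<close> is then a contradiction. For a step \<open>l(a)\<close> one uses
  \<open>\<langle>x(a)\<rangle>\<phi>[x/l]\<close>. Transitions and satisfaction are invariant under permutations of external names, and
  both source configurations are fixed by the transposition of \<open>l\<close> with another fresh name, so the
  choice of \<open>l\<close> does not matter.
\<close>

section \<open>Renaming the transaction names of terms\<close>

text \<open>The generated induction rule phrases the hypothesis for a sum through the set functions
  of options and pairs; here it speaks of the summands directly.\<close>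

lemma tm_induct [case_names Sum Par Res Var Rec Run Co Dorm]:
  assumes "\<And>f. (\<And>i \<mu> P. f i = Some (\<mu>, P) \<Longrightarrow> \<Phi> P) \<Longrightarrow> \<Phi> (Sum f)"
    and "\<And>P Q. \<Phi> P \<Longrightarrow> \<Phi> Q \<Longrightarrow> \<Phi> (Par P Q)"
    and "\<And>P. \<Phi> P \<Longrightarrow> \<Phi> (Res P)"
    and "\<And>n. \<Phi> (Var n)"
    and "\<And>P. \<Phi> P \<Longrightarrow> \<Phi> (Rec P)"
    and "\<And>P k Q. \<Phi> P \<Longrightarrow> \<Phi> Q \<Longrightarrow> \<Phi> (Run P k Q)"
    and "\<Phi> Co"
    and "\<And>P Q. \<Phi> P \<Longrightarrow> \<Phi> Q \<Longrightarrow> \<Phi> (Dorm P Q)"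
  shows "\<Phi> P"
proof (induction P)
  case (Sum f)
  show ?case
  proof (rule assms(1))
    fix i \<mu> P assume "f i = Some (\<mu>, P)"
    then show "\<Phi> P"
      using Sum[of "f i" "(\<mu>, P)" P] rangeI[of f i] by auto
  qed
qed (simp_all add: assms)

lemma map_trn_ren_res: "map_trn g (ren_res r P) = ren_res r (map_trn g P)"
  by (induction P arbitrary: r rule: tm_induct)
    (auto simp: fun_eq_iff option.map_comp intro!: option.map_cong)

lemma map_trn_ren_var: "map_trn g (ren_var r P) = ren_var r (map_trn g P)"
  by (induction P arbitrary: r rule: tm_induct)
    (auto simp: fun_eq_iff option.map_comp intro!: option.map_cong)

text \<open>Transaction names are independent of process variables and restriction indices, so
  renaming them commutes with substitution. This carries the unfolding rule of recursion.\<close>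

lemma map_trn_subst: "map_trn g (subst n R P) = subst n (map_trn g R) (map_trn g P)"
  by (induction P arbitrary: n R rule: tm_induct)
    (auto simp: fun_eq_iff option.map_comp map_trn_ren_res map_trn_ren_var intro!: option.map_cong)

lemma fv_map_trn: "fv (map_trn g P) = fv P"
proof (induction P rule: tm_induct)
  case (Sum f)
  then have "map_option (map_prod id fv \<circ> map_prod id (map_trn g)) (f i) = map_option (map_prod id fv) (f i)" for i
    by (cases "f i") auto
  then show ?case by (simp add: option.map_comp)
qed auto

lemma dangling_map_trn: "dangling (map_trn g P) = dangling P"
proof (induction P rule: tm_induct)
  case (Sum f)
  then have "map_option (map_prod id dangling \<circ> map_prod id (map_trn g)) (f i) = map_option (map_prod id dangling) (f i)" for i
    by (cases "f i") auto
  then show ?case by (simp add: option.map_comp)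
qed auto

section \<open>Well-formedness of renamed terms\<close>

lemma subterm_simps:
  "subterm R (Sum f)
    \<longleftrightarrow> R = Sum f \<or> (\<exists>i \<mu> P. f i = Some (\<mu>, P) \<and> subterm R P)"
  "subterm R (Par P Q) \<longleftrightarrow> R = Par P Q \<or> subterm R P \<or> subterm R Q"
  "subterm R (Res P) \<longleftrightarrow> R = Res P \<or> subterm R P"
  "subterm R (Var n) \<longleftrightarrow> R = Var n"
  "subterm R (Rec P) \<longleftrightarrow> R = Rec P \<or> subterm R P"
  "subterm R (Run P k Q) \<longleftrightarrow> R = Run P k Q \<or> subterm R P \<or> subterm R Q"
  "subterm R Co \<longleftrightarrow> R = Co"
  "subterm R (Dorm P Q) \<longleftrightarrow> R = Dorm P Q \<or> subterm R P \<or> subterm R Q"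
  by (auto simp: subterm.simps[of _ "Sum f"] subterm.simps[of _ "Par P Q"] subterm.simps[of _ "Res P"]
      subterm.simps[of _ "Var n"] subterm.simps[of _ "Rec P"] subterm.simps[of _ "Run P k Q"]
      subterm.simps[of _ Co] subterm.simps[of _ "Dorm P Q"])

text \<open>Renaming preserves the shape of a term, so conditions that quantify over subterms of
  \<open>map_trn g P\<close> can be traced back to subterms of \<open>P\<close>.\<close>

lemma subterm_map_trnD:
  "subterm R (map_trn g P) \<Longrightarrow> \<exists>R'. R = map_trn g R' \<and> subterm R' P"
proof (induction P rule: tm_induct)
  case (Sum f)
  from Sum.prems consider "R = map_trn g (Sum f)"
    | i \<mu> P where "f i = Some (\<mu>, P)" "subterm R (map_trn g P)"
    by (auto simp: subterm_simps)
  then show ?case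
  proof cases
    case 1
    then show ?thesis using subterm.intros(1) by blast
  next
    case (2 i \<mu> P)
    then show ?thesis using Sum.IH[OF 2(1)] subterm.intros(2) by blast
  qed
next
  case (Par P Q)
  then show ?case using tm.map(2)[of g P Q] by (metis subterm_simps(2))
next
  case (Res P)
  then show ?case using tm.map(3)[of g P] by (metis subterm_simps(3))
next
  case (Var n)
  then show ?case using tm.map(4)[of g n] by (metis subterm_simps(4))
next
  case (Rec P)
  then show ?case using tm.map(5)[of g P] by (metis subterm_simps(5))
next
  case (Run P k Q)
  then show ?case using tm.map(6)[of g P k Q] by (metis subterm_simps(6))
next
  case Co
  then show ?case using tm.map(7)[of g] by (metis subterm_simps(7))
next
  case (Dorm P Q)
  then show ?case using tm.map(8)[of g P Q] by (metis subterm_simps(8))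
qed

lemma map_trn_eq_Run: "Run P1 k Q1 = map_trn g R \<longleftrightarrow>
  (\<exists>P k' Q. R = Run P k' Q \<and> P1 = map_trn g P \<and> k = g k' \<and> Q1 = map_trn g Q)"
  by (cases R) auto

lemma map_trn_eq_Dorm: "Dorm P1 Q1 = map_trn g R \<longleftrightarrow>
  (\<exists>P Q. R = Dorm P Q \<and> P1 = map_trn g P \<and> Q1 = map_trn g Q)"
  by (cases R) auto

lemma map_trn_eq_Rec: "Rec P1 = map_trn g R
  \<longleftrightarrow> (\<exists>P. R = Rec P \<and> P1 = map_trn g P)"
  by (cases R) auto

lemma map_trn_eq_Sum: "Sum h = map_trn g R \<longleftrightarrow>
  (\<exists>f. R = Sum f \<and> h = map_option (map_prod id (map_trn g)) \<circ> f)"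
  by (cases R) auto

lemma no_dormant_map_trn: "no_dormant P \<Longrightarrow> no_dormant (map_trn g P)"
  unfolding no_dormant_def by (auto dest!: subterm_map_trnD simp: map_trn_eq_Dorm)

text \<open>The conditions on subterms ask for the absence of names, free variables or dormant
  transactions, and renaming introduces none of these.\<close>

lemma process_map_trn:
  assumes "process P"
  shows "process (map_trn g P)"
proof -
  note * = assms[unfolded process_def]
  have Run: "ftn P1 = {} \<and> ftn P1' = {} \<and> no_dormant P1 \<and> fv P1 = {}"
    if "subterm (Run P1 k P1') (map_trn g P)" for P1 k P1'
  proof -
    from subterm_map_trnD[OF that] obtain R k' R'
      where R: "subterm (Run R k' R') P" "P1 = map_trn g R" "P1' = map_trn g R'"
      by (auto simp: map_trn_eq_Run)
    then have "ftn R = {} \<and> ftn R' = {} \<and> no_dormant R \<and> fv R = {}"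
      using * by blast
    then show ?thesis
      using R by (simp add: tm.set_map fv_map_trn no_dormant_map_trn)
  qed
  have Dorm: "ftn P1 = {} \<and> ftn P1' = {} \<and> no_dormant P1 \<and> fv P1 = {}"
    if "subterm (Dorm P1 P1') (map_trn g P)" for P1 P1'
  proof -
    from subterm_map_trnD[OF that] obtain R R'
      where R: "subterm (Dorm R R') P" "P1 = map_trn g R" "P1' = map_trn g R'"
      by (auto simp: map_trn_eq_Dorm)
    then have "ftn R = {} \<and> ftn R' = {} \<and> no_dormant R \<and> fv R = {}"
      using * by blast
    then show ?thesis
      using R by (simp add: tm.set_map fv_map_trn no_dormant_map_trn)
  qed
  have Sum: "ftn Q = {} \<and> no_dormant Q"
    if "subterm (Sum f) (map_trn g P)" "f i = Some (\<mu>, Q)" for f i \<mu> Q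
  proof -
    from subterm_map_trnD[OF that(1)] that(2) obtain h R
      where R: "subterm (Sum h) P" "h i = Some (\<mu>, R)" "Q = map_trn g R"
      by (auto simp: map_trn_eq_Sum)
    then have "ftn R = {} \<and> no_dormant R"
      using * by blast
    then show ?thesis
      using R by (simp add: tm.set_map no_dormant_map_trn)
  qed
  have Rec: "ftn R = {}" if "subterm (Rec R) (map_trn g P)" for R
  proof -
    from subterm_map_trnD[OF that] obtain R' where R: "subterm (Rec R') P" "R = map_trn g R'"
      by (auto simp: map_trn_eq_Rec)
    then have "ftn R' = {}"
      using * by blast
    then show ?thesis
      using R by (simp add: tm.set_map)
  qed
  show ?thesis
    unfolding process_def
    proof (intro conjI)
    show "dangling (map_trn g P) = {}" "fv (map_trn g P) = {}" "finite (ftn (map_trn g P))"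
      using * by (simp_all add: dangling_map_trn fv_map_trn tm.set_map)
  qed (intro allI impI, erule Run Dorm Sum Rec, assumption?)+
qed

section \<open>Process transitions under injective renaming\<close>

lemma napp_map_nsub: "inj g \<Longrightarrow> napp (map_nsub g \<sigma>) (g k) = g (napp \<sigma> k)"
  by (cases \<sigma>) (auto dest: injD)

lemma map_trn_tapp: "inj g \<Longrightarrow> map_trn g (tapp P \<sigma>) = tapp (map_trn g P) (map_nsub g \<sigma>)"
  by (simp add: tm.map_comp o_def napp_map_nsub)

lemma nrange_map_nsub: "nrange (map_nsub g \<sigma>) = g ` nrange \<sigma>" by (cases \<sigma>) auto

lemma ndom_map_nsub: "ndom (map_nsub g \<sigma>) = g ` ndom \<sigma>" by (cases \<sigma>) auto

lemma image_Int_empty: "inj g \<Longrightarrow> g ` A \<inter> g ` B = {}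
  \<longleftrightarrow> A \<inter> B = {}"
  by (simp flip: image_Int)

text \<open>The rules carry transaction names along unchanged, and renaming commutes with the index
  renamings in scope extrusion and in swapping restrictions.\<close>

lemma struct_eq_map_trn: "P \<equiv>\<^sub>s Q \<Longrightarrow> map_trn g P \<equiv>\<^sub>s map_trn g Q"
proof (induction rule: struct_eq.induct)
  case (se_sum_reindex \<pi> f h)
  then show ?case
    using struct_eq.se_sum_reindex[of \<pi> "map_option (map_prod id (map_trn g)) \<circ> f"
        "map_option (map_prod id (map_trn g)) \<circ> h"]
    by (simp add: dom_def)
next
  case (se_sum_cong f h)
  have "rel_option (rel_prod (=) (\<equiv>\<^sub>s)) (map_option (map_prod id (map_trn g)) (f i))
      (map_option (map_prod id (map_trn g)) (h i))" for i
    using se_sum_cong[rule_format, of i] by (cases "f i"; cases "h i") auto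
  then show ?case
    by (auto intro: struct_eq.se_sum_cong)
next
  case (se_par_nil P) then show ?case using struct_eq.se_par_nil by (simp add: o_def)
next
  case (se_res_nil) then show ?case using struct_eq.se_res_nil by (simp add: o_def)
next
  case (se_res_swap P)
  then show ?case using struct_eq.se_res_swap[of "map_trn g P"] by (simp add: map_trn_ren_res)
qed (auto simp: map_trn_ren_res intro: struct_eq.intros)

lemma co_erase_map_trn: "P \<leadsto>\<^sub>c\<^sub>o Q \<Longrightarrow> map_trn g P \<leadsto>\<^sub>c\<^sub>o map_trn g Q"
  by (induction rule: co_erase.induct) (auto simp: o_def intro: co_erase.intros)

lemma reconf_map_trn:
  assumes "reconf P \<beta> Q" and g: "inj g"
  shows "reconf (map_trn g P) (map_rlab g \<beta>) (map_trn g Q)"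
  using assms(1)
proof (induction rule: reconf.induct)
  case (co P P'' P' k Q)
  then show ?case using struct_eq_map_trn[OF co(1), of g] co_erase_map_trn by (auto intro: reconf.intros)
next
  case (par_both \<beta> k P P' Q Q')
  then show ?case by (auto intro!: reconf.par_both[of _ "g k"])
next
  case (par_left P \<beta> P' Q)
  then show ?case
    using reconf.par_left[of "map_trn g P" "map_rlab g \<beta>" "map_trn g P'" "map_trn g Q"]
    by (simp add: image_Int_empty[OF g] tm.set_map rlab.set_map)
next
  case (par_right Q \<beta> Q' P)
  then show ?case
    using reconf.par_right[of "map_trn g Q" "map_rlab g \<beta>" "map_trn g Q'" "map_trn g P"]
    by (simp add: image_Int_empty[OF g] tm.set_map rlab.set_map)
qed (auto intro: reconf.intros)

text \<open>Injectivity of \<open>g\<close> preserves the inequality of names in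
  \<open>tr_run\<close> and the freshness conditions of the parallel rules, and makes renaming
  commute with applying a name substitution.\<close>

lemma ptrans_map_trn:
  assumes "ptrans P \<alpha> \<sigma> Q" and g: "inj g"
  shows "ptrans (map_trn g P) (map_lab (\<lambda>a. a) g \<alpha>) (map_nsub g \<sigma>) (map_trn g Q)"
  using assms(1)
proof (induction rule: ptrans.induct)
  case (sum f j \<mu> P)
  then show ?case by (auto intro!: ptrans.sum[of _ j] simp: pre.map_ident)
next
  case (unfold P)
  then show ?case using ptrans.unfold[of "map_trn g P"] by (simp add: map_trn_subst)
next
  case (tr_sum f j a P k)
  then show ?case by (auto simp: act.map_ident intro!: ptrans.tr_sum[of _ j])
next
  case (tr_run P \<mu> P' k l Q)
  then show ?case by (auto simp: inj_eq[OF g] pre.map_ident intro!: ptrans.tr_run)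
next
  case (tr_comm P k a ls1 P' Q ls2 Q')
  then show ?case using ptrans.tr_comm[of "map_trn g P" "g k" a "map g ls1" "map_trn g P'"
     "map_trn g Q" "map g ls2" "map_trn g Q'"]
    by (simp add: map_trn_tapp[OF g] act.map_ident)
next
  case (par_left P \<alpha> \<sigma> P' Q)
  then show ?case
    using ptrans.par_left[of "map_trn g P" "map_lab (\<lambda>a. a) g \<alpha>" "map_nsub g \<sigma>" "map_trn g P'" "map_trn g Q"]
    by (simp add: map_trn_tapp[OF g] nrange_map_nsub tm.set_map image_Int_empty[OF g])
next
  case (par_right Q \<alpha> \<sigma> Q' P)
  then show ?case
    using ptrans.par_right[of "map_trn g Q" "map_lab (\<lambda>a. a) g \<alpha>" "map_nsub g \<sigma>" "map_trn g Q'" "map_trn g P"]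
    by (simp add: map_trn_tapp[OF g] nrange_map_nsub tm.set_map image_Int_empty[OF g])
next
  case (res P \<alpha> \<sigma> P')
  then show ?case by (auto intro!: ptrans.res simp: lab.map_comp o_def)
next
  case (comm P a P' Q Q')
  then show ?case by (auto intro!: ptrans.comm[of _ a] simp: act.map_ident)
qed

section \<open>Abstracting names in formulae\<close>

lemma form_struct_induct [case_names Dia DiaAct Neg Conj EqCo]:
  assumes "\<And>\<phi>. \<Phi> \<phi> \<Longrightarrow> \<Phi> (Dia \<phi>)"
    and "\<And>x a \<phi>. \<Phi> \<phi> \<Longrightarrow> \<Phi> (DiaAct x a \<phi>)"
    and "\<And>\<phi>. \<Phi> \<phi> \<Longrightarrow> \<Phi> (Neg \<phi>)"
    and "\<And>f. (\<And>i \<phi>. f i = Some \<phi> \<Longrightarrow> \<Phi> \<phi>) \<Longrightarrow> \<Phi> (Conj f)"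
    and "\<And>v w. \<Phi> (EqCo v w)"
  shows "\<Phi> \<phi>"
proof (induction \<phi>)
  case (Conj f)
  show ?case
  proof (rule assms(4))
    fix i \<phi> assume "f i = Some \<phi>"
    then show "\<Phi> \<phi>"
      using Conj[of "f i" \<phi>] rangeI[of f i] by auto
  qed
qed (simp_all add: assms)

text \<open>Satisfaction of \<open>DiaAct x a \<phi>\<close> refers to the instances
  \<open>fsubst l x \<phi>\<close>, so the hypothesis covers all of them. The induction is
  well-founded because substitution leaves \<open>shape\<close> unchanged.\<close>

lemma form_subst_induct [case_names Dia DiaAct Neg Conj EqCo]:
  assumes "\<And>\<phi>. \<Phi> \<phi> \<Longrightarrow> \<Phi> (Dia \<phi>)"
    and "\<And>x a \<phi>. (\<And>l. \<Phi> (fsubst l x \<phi>)) \<Longrightarrow> \<Phi> (DiaAct x a \<phi>)"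
    and "\<And>\<phi>. \<Phi> \<phi> \<Longrightarrow> \<Phi> (Neg \<phi>)"
    and "\<And>f. (\<And>i \<phi>. f i = Some \<phi> \<Longrightarrow> \<Phi> \<phi>) \<Longrightarrow> \<Phi> (Conj f)"
    and "\<And>v w. \<Phi> (EqCo v w)"
  shows "\<Phi> \<phi>"
proof (induction \<phi> rule: wf_induct_rule[OF wf_inv_image[OF wf_child, of shape]])
  case (1 \<phi>)
  note IH = 1[unfolded in_inv_image]
  show ?case
  proof (cases \<phi>)
    case (Dia \<psi>)
    show ?thesis unfolding Dia
      by (rule assms(1)) (simp add: IH Dia child.intros)
  next
    case (DiaAct x a \<psi>)
    show ?thesis unfolding DiaAct
      by (rule assms(2)) (simp add: IH DiaAct shape_fsubst child.intros)
  next
    case (Neg \<psi>)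
    show ?thesis unfolding Neg
      by (rule assms(3)) (simp add: IH Neg child.intros)
  next
    case (Conj f)
    show ?thesis unfolding Conj
    proof (rule assms(4))
      fix i \<psi> assume "f i = Some \<psi>"
      then show "\<Phi> \<psi>"
        using IH[of \<psi>] by (simp add: Conj child.intros(4)[of _ i])
    qed
  qed (simp add: assms(5))
qed

abbreviation names_form :: "('n, 'e, 'i) form \<Rightarrow> 'e set" where
  "names_form \<equiv> set2_form"

abbreviation ren_form :: "('e \<Rightarrow> 'e) \<Rightarrow> ('n, 'e, 'i) form \<Rightarrow> ('n, 'e, 'i) form" where
  "ren_form f \<equiv> map_form (\<lambda>a. a) f"

primrec bvars :: "('n, 'e, 'i) form \<Rightarrow> nat set" where
  "bvars (Dia \<phi>) = bvars \<phi>"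
| "bvars (DiaAct x a \<phi>) = insert x (bvars \<phi>)"
| "bvars (Neg \<phi>) = bvars \<phi>"
| "bvars (Conj f) = \<Union>(ran (\<lambda>i. map_option bvars (f i)))"
| "bvars (EqCo v w) = {}"

text \<open>This is \<open>\<phi>[x/l]\<close>, a converse of \<open>fsubst\<close>. It also
  replaces below binders of \<open>x\<close>; capture is excluded by requiring \<open>x\<close> to
  lie outside \<open>bvars \<phi>\<close>.\<close>

primrec abstract_name :: "'e \<Rightarrow> nat \<Rightarrow> ('n, 'e, 'i) form \<Rightarrow> ('n, 'e, 'i) form" where
  "abstract_name l x (Dia \<phi>) = Dia (abstract_name l x \<phi>)"
| "abstract_name l x (DiaAct y a \<phi>) = DiaAct y a (abstract_name l x \<phi>)"
| "abstract_name l x (Neg \<phi>) = Neg (abstract_name l x \<phi>)"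
| "abstract_name l x (Conj f) = Conj (\<lambda>i. map_option (abstract_name l x) (f i))"
| "abstract_name l x (EqCo v w) =
     EqCo (if v = Inl l then Inr x else v) (if w = Inl l then Inr x else w)"

lemma free_vars_Conj: "free_vars (Conj f) = (\<Union>\<phi>\<in>ran f. free_vars \<phi>)"
  by (auto simp: ran_def)

lemma bvars_Conj: "bvars (Conj f) = (\<Union>\<phi>\<in>ran f. bvars \<phi>)"
  by (auto simp: ran_def)

lemma names_form_Conj: "names_form (Conj f) = (\<Union>\<phi>\<in>ran f. names_form \<phi>)"
  by (auto simp: ran_def)

lemma ran_map_option: "ran (\<lambda>i. map_option g (f i)) = g ` ran f"
  by (auto simp: ran_def)

declare free_vars.simps(4) [simp del] bvars.simps(4) [simp del] form.set(9) [simp del]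
declare free_vars_Conj [simp] bvars_Conj [simp] names_form_Conj [simp] ran_map_option [simp]

lemma ranE: "x \<in> ran f \<Longrightarrow> (\<And>i. f i = Some x \<Longrightarrow> thesis) \<Longrightarrow> thesis"
  by (auto simp: ran_def)

lemma free_vars_fsubst: "free_vars (fsubst l x \<phi>) = free_vars \<phi> - {x}"
proof (induction \<phi> rule: form_struct_induct)
  case (Conj f)
  then have "free_vars (fsubst l x \<phi>) = free_vars \<phi> - {x}" if "\<phi> \<in> ran f" for \<phi>
    using that by (blast elim: ranE)
  then show ?case by simp
qed auto

lemma free_vars_abstract_name: "free_vars (abstract_name l x \<phi>) \<subseteq> insert x (free_vars \<phi>)"
proof (induction \<phi> rule: form_struct_induct)
  case (Conj f)
  then have "free_vars (abstract_name l x \<phi>) \<subseteq> insert x (free_vars \<phi>)"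
    if "\<phi> \<in> ran f" for \<phi>
    using that by (blast elim: ranE)
  then show ?case by fastforce
qed auto

lemma bvars_abstract_name: "bvars (abstract_name l x \<phi>) = bvars \<phi>"
proof (induction \<phi> rule: form_struct_induct)
  case (Conj f)
  then have "bvars (abstract_name l x \<phi>) = bvars \<phi>" if "\<phi> \<in> ran f" for \<phi>
    using that by (blast elim: ranE)
  then show ?case by simp
qed auto

lemma names_form_abstract_name: "names_form (abstract_name l x \<phi>) = names_form \<phi> - {l}"
proof (induction \<phi> rule: form_struct_induct)
  case (Conj f)
  then have "names_form (abstract_name l x \<phi>) = names_form \<phi> - {l}"
    if "\<phi> \<in> ran f" for \<phi>
    using that by (blast elim: ranE)
  then show ?case by simp
qed (auto simp: setl.simps)

lemma ren_form_fsubst: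
  assumes "inj f"
  shows "ren_form f (fsubst l x \<phi>) = fsubst (f l) x (ren_form f \<phi>)"
proof (induction \<phi> rule: form_struct_induct)
  case (Conj h)
  have "map_option (ren_form f \<circ> fsubst l x) (h i) = map_option (fsubst (f l) x \<circ> ren_form f) (h i)" for i
    using Conj[of i] by (cases "h i") simp_all
  then show ?case by (simp add: option.map_comp fun_eq_iff)
next
  case (EqCo v w)
  then show ?case by (cases v; cases w) auto
qed auto

text \<open>The two operations together replace \<open>l\<close> by \<open>l'\<close>. As
  \<open>l'\<close> is \<open>l\<close> itself or does not occur in \<open>\<phi>\<close>, this
  agrees with the transposition, which is a bijection and can be moved from the formula to the
  configuration.\<close>

lemma fsubst_abstract_name:
  assumes "x \<notin> bvars \<phi>" "x \<notin> free_vars \<phi>" "l' \<notin> names_form \<phi> - {l}"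
  shows "fsubst l' x (abstract_name l x \<phi>) = ren_form (transpose l l') \<phi>"
  using assms
proof (induction \<phi> rule: form_struct_induct)
  case (Conj h)
  then have "fsubst l' x (abstract_name l x \<phi>) = ren_form (transpose l l') \<phi>"
    if "h i = Some \<phi>" for i \<phi>
    using that ranI[of h i \<phi>] by (intro Conj(1)) (auto simp: ran_def)
  then have "map_option (fsubst l' x \<circ> abstract_name l x) (h i) = map_option (ren_form (transpose l l')) (h i)" for i
    by (cases "h i") auto
  then show ?case by (simp add: option.map_comp fun_eq_iff)
next
  case (EqCo v w)
  then show ?case by (cases v; cases w) (auto simp: transpose_def setl.simps)
qed (auto simp: act.map_ident)

section \<open>Equivariance of configurations and satisfaction\<close>

text \<open>Internal names stay fixed: labels, histories and formulae mention only external
  ones.\<close>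

abbreviation ren_trn :: "('e \<Rightarrow> 'e) \<Rightarrow> ('m, 'e) trn \<Rightarrow> ('m, 'e) trn" where
  "ren_trn f \<equiv> trn.map_trn (\<lambda>a. a) f"

abbreviation ren_hist :: "('e \<Rightarrow> 'e) \<Rightarrow> ('n, 'e) hist \<Rightarrow> ('n, 'e) hist" where
  "ren_hist f H \<equiv> map_option (map_hentry (\<lambda>a. a) f) \<circ> H"

abbreviation ren_rel :: "('a \<Rightarrow> 'b) \<Rightarrow> ('a \<times> 'a) set \<Rightarrow> ('b \<times> 'b) set" where
  "ren_rel g E \<equiv> map_prod g g ` E"

primrec ren_conf :: "('e \<Rightarrow> 'e) \<Rightarrow> ('n, 'm, 'e) conf \<Rightarrow> ('n, 'm, 'e) conf" where
  "ren_conf f (Conf E H P) =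
     Conf (ren_rel (ren_trn f) E) (ren_hist f H) (map_trn (ren_trn f) P)"

lemma bij_ren_trn: "bij f \<Longrightarrow> bij (ren_trn f)"
  by (rule o_bij[of "trn.map_trn (\<lambda>a. a) (inv f)"])
    (simp_all add: fun_eq_iff trn.map_comp bij_is_inj bij_is_surj o_def surj_f_inv_f trn.map_ident)

lemma in_ren_rel_iff: "inj g \<Longrightarrow> (g a, g b) \<in> ren_rel g E
  \<longleftrightarrow> (a, b) \<in> E"
  by (auto simp: inj_eq)

lemma Field_ren_rel: "Field (ren_rel g E) = g ` Field E"
  by (force simp: Field_def)

lemma equiv_ren_rel:
  assumes g: "inj g" and E: "equiv A E"
  shows "equiv (g ` A) (ren_rel g E)"
proof (rule equivI)
  show "ren_rel g E \<subseteq> g ` A \<times> g ` A"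
    using E by (auto simp: equiv_def)
  show "refl_on (g ` A) (ren_rel g E)"
    using E unfolding equiv_def refl_on_def by fastforce
  show "sym (ren_rel g E)"
    using E by (auto simp: equiv_def intro!: symI dest: symD)
  show "trans (ren_rel g E)"
  proof (rule transI)
    fix x y z assume "(x, y) \<in> ren_rel g E" "(y, z) \<in> ren_rel g E"
    obtain a b where "x = g a" "y = g b" "(a, b) \<in> E"
      using \<open>(x, y) \<in> ren_rel g E\<close> by auto
    moreover obtain b' c where "y = g b'" "z = g c" "(b', c) \<in> E"
      using \<open>(y, z) \<in> ren_rel g E\<close> by auto
    ultimately have *: "x = g a" "y = g b" "y = g b'" "z = g c" "(a, b) \<in> E" "(b', c) \<in> E"
      by simp_all
    then have "b' = b"
      using g by (auto dest: injD)
    with * E have "(a, c) \<in> E"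
      unfolding equiv_def by (blast dest: transD)
    then show "(x, z) \<in> ren_rel g E"
      using * by auto
  qed
qed

lemma equiv_inv_image: "equiv A E \<Longrightarrow> equiv (g -` A) (inv_image E g)"
  by (auto simp: equiv_def inv_image_def refl_on_def intro!: symI transI dest: symD transD)

lemma merge_ren_rel:
  assumes g: "bij g"
  shows "merge (map_nsub g \<sigma>) (ren_rel g E) = ren_rel g (merge \<sigma> E)"
proof (rule antisym; rule subrelI)
  note inj = bij_is_inj[OF g]
  fix a' b' assume *: "(a', b') \<in> merge (map_nsub g \<sigma>) (ren_rel g E)"
  obtain a b where ab: "a' = g a" "b' = g b"
    using g by (meson bij_pointE)
  have "(a, b) \<in> F" if "equiv A F" "E \<subseteq> F"
    "\<forall>l\<in>nrange \<sigma>. (l, l) \<in> F \<and> (\<forall>k\<in>ndom \<sigma>. (k, l) \<in> F)" for A F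
  proof -
    have "(a', b') \<in> ren_rel g F"
      using * that equiv_ren_rel[OF inj that(1)] unfolding merge_def
      by (auto simp: nrange_map_nsub ndom_map_nsub in_ren_rel_iff[OF inj]
          elim!: allE[of _ "ren_rel g F"] simp del: map_prod_imageI)
    then show ?thesis
      by (simp add: ab in_ren_rel_iff[OF inj])
  qed
  then have "(a, b) \<in> merge \<sigma> E"
    unfolding merge_def by blast
  then show "(a', b') \<in> ren_rel g (merge \<sigma> E)"
    by (simp add: ab in_ren_rel_iff[OF inj])
next
  note inj = bij_is_inj[OF g]
  fix a' b' assume "(a', b') \<in> ren_rel g (merge \<sigma> E)"
  then obtain a b where ab: "a' = g a" "b' = g b" and *: "(a, b) \<in> merge \<sigma> E"
    by auto
  have "(a', b') \<in> F" if "equiv A F" "ren_rel g E \<subseteq> F"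
    "\<forall>l\<in>nrange (map_nsub g \<sigma>). (l, l) \<in> F \<and> (\<forall>k\<in>ndom (map_nsub g \<sigma>). (k, l) \<in> F)" for A F
  proof -
    have "(a, b) \<in> inv_image F g"
      using * that equiv_inv_image[OF that(1), of g] unfolding merge_def
      by (auto simp: nrange_map_nsub ndom_map_nsub elim!: allE[of _ "inv_image F g"])
    then show ?thesis
      by (simp add: ab)
  qed
  then show "(a', b') \<in> merge (map_nsub g \<sigma>) (ren_rel g E)"
    unfolding merge_def by blast
qed

lemma hname_map_hentry: "hname (map_hentry (\<lambda>a. a) f h) = f (hname h)"
  by (cases h) auto

lemma htrn_ren_hist: "htrn (ren_hist f H) = f ` htrn H"
  by (auto simp: htrn_def ran_def hname_map_hentry image_iff) (metis hname_map_hentry)+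

lemma hasco_ren_hist: "hasco (ren_hist f H) = f ` hasco H"
proof -
  have *: "map_hentry (\<lambda>a. a) f h = HCo k
    \<longleftrightarrow> (\<exists>k'. h = HCo k' \<and> k = f k')" for h :: "('n, 'a) hentry" and k
    by (cases h) auto
  show ?thesis
    unfolding hasco_def by (auto simp: *)
qed

lemma Ex_image_ren_trn: "Ex ` f ` A = ren_trn f ` Ex ` A"
  by (simp add: image_image)

lemma names_env_ren: "names_env (ren_rel (ren_trn f) E) (ren_hist f H) = ren_trn f ` names_env E H"
  by (simp only: names_env_def htrn_ren_hist Field_ren_rel Ex_image_ren_trn image_Un)

text \<open>Marking depends only on whether the name of an entry is related to \<open>k\<close>,
  which an injective renaming preserves. The constructor \<open>c\<close> stands for
  \<open>HCo\<close> or \<open>HAb\<close>.\<close>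

lemma mark_map_hentry:
  assumes "inj g" "\<And>k. g (Ex k) = Ex (f k)" "\<And>k. map_hentry (\<lambda>a. a) f (c k) = c (f k)"
  shows "map_hentry (\<lambda>a. a) f (mark c E k h) = mark c (ren_rel g E) (g k) (map_hentry (\<lambda>a. a) f h)"
  using assms(3) in_ren_rel_iff[OF assms(1), of "Ex _" k E]
  by (cases h) (auto simp: mark_def assms(2))

lemma ren_hist_mark:
  assumes f: "bij f"
  shows "ren_hist f (mark_co E k H) = mark_co (ren_rel (ren_trn f) E) (ren_trn f k) (ren_hist f H)"
    and "ren_hist f (mark_ab E k H) = mark_ab (ren_rel (ren_trn f) E) (ren_trn f k) (ren_hist f H)"
  by (auto simp: fun_eq_iff mark_co_def mark_ab_def option.map_comp o_def
      mark_map_hentry[OF bij_is_inj[OF bij_ren_trn[OF f]]])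

lemma config_ConfD:
  assumes "config (Conf E H P)"
  shows "process P"
    and "\<exists>A. finite A \<and> equiv A E"
    and "finite (dom H)"
    and "\<forall>i j h h'. H i = Some h \<longrightarrow> H j = Some h' \<longrightarrow> hname h = hname h' \<longrightarrow> i = j"
    and "\<forall>k. (Ex k, Ex k) \<in> E \<longleftrightarrow> k \<in> htrn H"
    and "\<forall>k k'. (Ex k, Ex k') \<in> E \<longrightarrow> (k \<in> hasco H
      \<longleftrightarrow> k' \<in> hasco H)"
    and "ftn P \<inter> Ex ` hasco H = {}"
    and "\<forall>k k'. (k, k') \<in> E \<longrightarrow> k \<in> ftn P \<longrightarrow> k' \<in> ftn P \<longrightarrow> k = k'"
    and "ftn P \<inter> range Ex \<subseteq> Ex ` htrn H"
  using assms unfolding config_def conf.case by - (elim conjE, assumption)+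

lemma config_ren_conf:
  assumes f: "bij f" and C: "config C"
  shows "config (ren_conf f C)"
proof -
  obtain E H P where CE: "C = Conf E H P" by (cases C)
  let ?g = "ren_trn f :: ('c, 'a) trn \<Rightarrow> ('c, 'a) trn"
  note injf = bij_is_inj[OF f]
  have inj: "inj ?g" by (rule bij_is_inj[OF bij_ren_trn[OF f]])
  note C' = config_ConfD[OF C[unfolded CE]]
  \<comment> \<open>The conditions on \<open>E\<close> and the history quantify over all external
    names; by surjectivity each of them is the image of another.\<close>
  have f_ex: "\<exists>k0. k = f k0" for k
    using f by (meson bij_pointE)
  have E_iff: "(Ex (f k), Ex (f k')) \<in> ren_rel ?g E \<longleftrightarrow> (Ex k, Ex k') \<in> E" for k k'
    using in_ren_rel_iff[OF inj, of "Ex k" "Ex k'" E] by simp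
  show ?thesis
    unfolding CE ren_conf.simps config_def conf.case htrn_ren_hist hasco_ren_hist tm.set_map
  proof (intro conjI allI)
    show "process (map_trn ?g P)"
      by (rule process_map_trn[OF C'(1)])
    show "\<exists>A. finite A \<and> equiv A (ren_rel ?g E)"
      using C'(2) equiv_ren_rel[OF inj] by (meson finite_imageI)
    show "finite (dom (ren_hist f H))"
      using C'(3) by (simp add: dom_map_option_comp)
    show "ren_hist f H i = Some h \<longrightarrow> ren_hist f H j = Some h' \<longrightarrow> hname h = hname h' \<longrightarrow> i = j"
      for i j h h'
      using C'(4) by (auto simp: hname_map_hentry inj_eq[OF injf])
    show "(Ex k, Ex k) \<in> ren_rel ?g E \<longleftrightarrow> k \<in> f ` htrn H" for k
    proof -
      obtain k0 where "k = f k0" using f_ex by blast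
      then show ?thesis using C'(5) by (simp only: E_iff inj_image_mem_iff[OF injf])
    qed
    show "(Ex k, Ex k') \<in> ren_rel ?g E \<longrightarrow> (k \<in> f ` hasco H
      \<longleftrightarrow> k' \<in> f ` hasco H)" for k k'
    proof -
      obtain k0 k1 where "k = f k0" "k' = f k1" using f_ex by metis
      then show ?thesis using C'(6) by (simp only: E_iff inj_image_mem_iff[OF injf]) simp
    qed
    show "?g ` ftn P \<inter> Ex ` f ` hasco H = {}"
      using C'(7) by (simp only: Ex_image_ren_trn image_Int_empty[OF inj])
    show "(k, k') \<in> ren_rel ?g E \<longrightarrow> k \<in> ?g ` ftn P \<longrightarrow> k' \<in> ?g ` ftn P \<longrightarrow> k = k'" for k k'
      using C'(8) by (auto simp: inj_eq[OF inj])
    show "?g ` ftn P \<inter> range Ex \<subseteq> Ex ` f ` htrn H"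
    proof
      fix x assume "x \<in> ?g ` ftn P \<inter> range Ex"
      then obtain y k where y: "y \<in> ftn P" "x = ?g y" "x = Ex k" by blast
      \<comment> \<open>\<open>ren_trn f\<close> keeps internal names internal, so an external image
        comes from an external name.\<close>
      then obtain k' where k': "y = Ex k'"
        by (cases y rule: trn.exhaust) simp_all
      with y C'(9) have "k' \<in> htrn H" by auto
      with y k' show "x \<in> Ex ` f ` htrn H" by auto
    qed
  qed
qed

section \<open>Extended transitions under permutations of external names\<close>

abbreviation ren_elab :: "('e \<Rightarrow> 'e) \<Rightarrow> ('n, 'e) elab \<Rightarrow> ('n, 'e) elab" where
  "ren_elab f \<equiv> map_elab (\<lambda>a. a) f"

text \<open>A bijection preserves freshness, and \<open>ren_trn f\<close> respects the split into
  internal and external names on which the rules depend.\<close>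

lemma etrans_rule_ren:
  assumes "etrans_rule C \<zeta> C'" and f: "bij f"
  shows "etrans_rule (ren_conf f C) (ren_elab f \<zeta>) (ren_conf f C')"
proof -
  let ?g = "ren_trn f :: ('b, 'c) trn \<Rightarrow> ('b, 'c) trn"
  have g: "bij ?g" by (rule bij_ren_trn[OF f])
  note inj = bij_is_inj[OF g]
  note mem = inj_image_mem_iff[OF inj]
  have Ex_mem: "Ex (f k) \<in> ?g ` X \<longleftrightarrow> Ex k \<in> X" for k X
    using mem[of "Ex k" X] by simp
  note [simp] = names_env_ren mem Ex_mem merge_ren_rel[OF g] ren_hist_mark[OF f] tm.set_map
  have upd: "ren_hist f (H(i \<mapsto> h)) = (ren_hist f H)(i \<mapsto> map_hentry (\<lambda>a. a) f h)" for H :: "('a, 'c) hist" and i h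
    by (auto simp: fun_eq_iff)
  show ?thesis
    using assms(1)
  proof cases
    case (1 P Q E H)
    then show ?thesis using ptrans_map_trn[OF 1(4) inj]
      by (auto intro: etrans_rule.intros(1))
  next
    case (2 P k \<sigma> Q E H)
    then have "?g k \<in> range In" by auto
    then show ?thesis
      using 2 ptrans_map_trn[OF 2(4) inj]
        etrans_rule.intros(2)[of "map_trn ?g P" "?g k" "map_nsub ?g \<sigma>"
          "map_trn ?g Q" "ren_rel ?g E" "ren_hist f H"]
      by simp
  next
    case (3 P k Q E H)
    then have "?g k \<in> range In" by auto
    then show ?thesis
      using 3 reconf_map_trn[OF 3(4) inj] etrans_rule.intros(3)[of "map_trn ?g P" "?g k"
          "map_trn ?g Q" "ren_rel ?g E" "ren_hist f H"]
      by simp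
  next
    case (4 P k Q E H)
    then show ?thesis using reconf_map_trn[OF 4(4) inj]
      by (auto intro!: etrans_rule.intros(4))
  next
    case (5 P k Q E H)
    then show ?thesis using reconf_map_trn[OF 5(4) inj]
      by (auto intro!: etrans_rule.intros(5))
  next
    case (6 P k a \<sigma> Q E H i)
    then show ?thesis using ptrans_map_trn[OF 6(4) inj]
      etrans_rule.intros(6)[of "map_trn ?g P" "f k" a "map_nsub ?g \<sigma>" "map_trn ?g Q" "ren_rel ?g E" "ren_hist f H" i]
      by (simp add: upd act.map_ident dom_map_option_comp merge_ren_rel[OF g])
  next
    case (7 k E H P i)
    then show ?thesis using etrans_rule.intros(7)[of "f k" "ren_rel ?g E" "ren_hist f H" "map_trn ?g P" i]
      by (simp add: upd act.map_ident dom_map_option_comp)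
  qed
qed

lemma etrans_ren:
  "etrans C \<zeta> C' \<Longrightarrow> bij f \<Longrightarrow> etrans (ren_conf f C) (ren_elab f \<zeta>) (ren_conf f C')"
  by (simp add: etrans_def config_ren_conf etrans_rule_ren)

lemma weak_tau_ren: "weak_tau C C' \<Longrightarrow> bij f \<Longrightarrow> weak_tau (ren_conf f C) (ren_conf f C')"
  by (induction rule: rtranclp_induct)
    (auto dest: etrans_ren[of _ ETau, simplified] elim!: rtranclp.rtrancl_into_rtrancl)

lemma weak_ren:
  assumes "weak C \<zeta> C'" and f: "bij f"
  shows "weak (ren_conf f C) (ren_elab f \<zeta>) (ren_conf f C')"
proof (cases \<zeta>)
  case ETau
  then show ?thesis
    using assms weak_tau_ren by (simp add: weak_def)
next
  case (EAct l a)
  then obtain D D' where "weak_tau C D" "etrans D \<zeta> D'" "weak_tau D' C'"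
    using assms by (auto simp: weak_def)
  then have "weak_tau (ren_conf f C) (ren_conf f D)"
    "etrans (ren_conf f D) (ren_elab f \<zeta>) (ren_conf f D')"
    "weak_tau (ren_conf f D') (ren_conf f C')"
    using f by (auto intro: weak_tau_ren etrans_ren)
  moreover have "ren_elab f \<zeta> \<noteq> ETau"
    by (simp add: EAct)
  ultimately show ?thesis
    unfolding weak_def by auto
qed

lemma ren_conf_comp: "ren_conf f (ren_conf h C) = ren_conf (f \<circ> h) C"
  by (cases C) (simp add: image_image o_def prod.map_comp map_prod_compose trn.map_comp tm.map_comp
      option.map_comp hentry.map_comp case_prod_unfold map_prod_def)

text \<open>Every external name of a configuration is recorded in its history: those in
  \<open>E\<close> because \<open>E\<close> is reflexive on its field, those in the process by
  convention. Hence swapping two unrecorded names fixes the configuration.\<close>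

lemma ren_conf_ident:
  assumes C: "config C" and f: "\<And>k. k \<in> htrn (hist C) \<Longrightarrow> f k = k"
  shows "ren_conf f C = C"
proof -
  obtain E H P where CE: "C = Conf E H P" by (cases C)
  note C' = config_ConfD[OF C[unfolded CE]]
  have Ex_fixed: "f k = k" if "(Ex k, Ex k) \<in> E" for k
    using that C'(5) f[of k] CE by simp
  obtain A where A: "equiv A E" using C'(2) by blast
  have "ren_trn f x = x \<and> ren_trn f y = y" if "(x, y) \<in> E" for x y
  proof -
    have "(x, x) \<in> E" "(y, y) \<in> E"
      using A that unfolding equiv_def refl_on_def by auto
    then show ?thesis
      using Ex_fixed by (cases x; cases y) auto
  qed
  then have "map_prod (ren_trn f) (ren_trn f) p = p" if "p \<in> E" for p
    using that by (cases p) auto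
  then have 1: "ren_rel (ren_trn f) E = E"
    by simp
  have "map_hentry (\<lambda>a. a) f h = h" if "H i = Some h" for i h
  proof -
    have "hname h \<in> htrn H"
      using that by (auto simp: htrn_def ran_def)
    then show ?thesis
      using f[of "hname h"] CE by (cases h) (auto simp: act.map_ident)
  qed
  then have "map_option (map_hentry (\<lambda>a. a) f) (H i) = H i" for i
    by (cases "H i") auto
  then have 2: "ren_hist f H = H"
    by (simp add: fun_eq_iff)
  have "ren_trn f k = k" if "k \<in> ftn P" for k
  proof (cases k)
    case (Ex e)
    then have "e \<in> htrn H"
      using that C'(9) by auto
    then show ?thesis
      using Ex f[of e] CE by simp
  qed simp
  then have "map_trn (ren_trn f) P = map_trn (\<lambda>k. k) P"
    by (intro tm.map_cong) auto
  then have 3: "map_trn (ren_trn f) P = P"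
    by (simp add: tm.map_ident)
  show ?thesis
    by (simp add: CE 1 2 3)
qed

lemma ren_conf_id: "ren_conf (\<lambda>k. k) C = C"
  by (cases C) (simp add: trn.map_ident[abs_def] hentry.map_ident[abs_def]
    tm.map_ident option.map_ident[abs_def] fun_eq_iff
      prod.map_ident[abs_def])

lemma ren_conf_inv:
  "bij f \<Longrightarrow> ren_conf (inv f) (ren_conf f C) = C"
  "bij f \<Longrightarrow> ren_conf f (ren_conf (inv f) C) = C"
  by (simp_all add: ren_conf_comp bij_is_inj bij_is_surj o_def surj_f_inv_f ren_conf_id)

text \<open>Renaming back along \<open>inv f\<close> turns a transition of
  \<open>ren_conf f C\<close> into one of \<open>C\<close>.\<close>

lemma weak_ren_iff:
  assumes f: "bij f"
  shows "weak (ren_conf f C) (ren_elab f \<zeta>) D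
    \<longleftrightarrow> (\<exists>C'. D = ren_conf f C' \<and> weak C \<zeta> C')"
proof
  have "ren_elab (inv f) (ren_elab f \<zeta>) = \<zeta>"
    by (cases \<zeta>) (simp_all add: act.map_comp act.map_ident o_def bij_is_inj[OF f])
  moreover assume "weak (ren_conf f C) (ren_elab f \<zeta>) D"
  ultimately have "weak C \<zeta> (ren_conf (inv f) D)"
    using weak_ren[of "ren_conf f C" "ren_elab f \<zeta>" D "inv f"] f
    by (simp add: bij_imp_bij_inv ren_conf_inv)
  then show "\<exists>C'. D = ren_conf f C' \<and> weak C \<zeta> C'"
    using ren_conf_inv(2)[OF f, of D] by metis
qed (use weak_ren f in blast)

section \<open>Satisfaction under permutations of external names\<close>

lemma co_eq_ren:
  assumes f: "bij f"
  shows "co_eq (ren_conf f C) (f k) (f k') \<longleftrightarrow> co_eq C k k'"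
proof (cases C)
  case (Conf E H P)
  have "(Ex (f k), Ex (f k')) \<in> ren_rel (ren_trn f) E \<longleftrightarrow> (Ex k, Ex k') \<in> E"
    using in_ren_rel_iff[OF bij_is_inj[OF bij_ren_trn[OF f]], of "Ex k" "Ex k'" E] by simp
  then show ?thesis
    by (simp add: Conf co_eq_def hasco_ren_hist inj_image_mem_iff[OF bij_is_inj[OF f]])
qed

text \<open>The best choice of the cofinite set is the set of all names that succeed, so only the
  finiteness of its complement matters.\<close>

lemma sat_DiaAct:
  "sat C (DiaAct x a \<phi>)
    \<longleftrightarrow> finite {l. \<nexists>C'. weak C (EAct l a) C' \<and> sat C' (fsubst l x \<phi>)}"
  (is "_ \<longleftrightarrow> finite ?B")
proof
  assume "sat C (DiaAct x a \<phi>)"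
  then obtain N
    where N: "finite (- N)" "\<forall>l\<in>N. \<exists>C'. weak C (EAct l a) C' \<and> sat C' (fsubst l x \<phi>)"
    by auto
  then have "?B \<subseteq> - N"
    by blast
  then show "finite ?B"
    by (rule finite_subset[OF _ N(1)])
next
  assume "finite ?B"
  then show "sat C (DiaAct x a \<phi>)"
    by (auto intro!: exI[of _ "- ?B"])
qed

text \<open>For the action modality, the failing names of \<open>C\<close> are the preimage under
  \<open>f\<close> of those of \<open>ren_conf f C\<close>, so both sets are finite or neither
  is.\<close>

lemma sat_ren:
  assumes f: "bij f"
  shows "sat (ren_conf f C) (ren_form f \<phi>) \<longleftrightarrow> sat C \<phi>"
proof (induction \<phi> arbitrary: C rule: form_subst_induct)
  case (Dia \<phi>)
  have "weak (ren_conf f C) ETau D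
    \<longleftrightarrow> (\<exists>C'. D = ren_conf f C' \<and> weak C ETau C')" for D
    using weak_ren_iff[OF f, of C ETau D] by simp
  then show ?case using Dia by auto
next
  case (DiaAct x a \<phi>)
  have w: "weak (ren_conf f C) (EAct (f l) a) D
    \<longleftrightarrow> (\<exists>C'. D = ren_conf f C' \<and> weak C (EAct l a) C')" for D l
    using weak_ren_iff[OF f, of C "EAct l a" D] by (simp add: act.map_ident)
  let ?Q = "\<lambda>l. \<exists>C'. weak C (EAct l a) C' \<and> sat C' (fsubst l x \<phi>)"
  let ?Q' = "\<lambda>l. \<exists>D. weak (ren_conf f C) (EAct l a) D \<and> sat D (fsubst l x (ren_form f \<phi>))"
  have "?Q' (f l) \<longleftrightarrow> ?Q l" for l
    using DiaAct[of _ l] by (auto simp: w simp flip: ren_form_fsubst[OF bij_is_inj[OF f]])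
  then have *: "{l. \<not> ?Q l} = f -` {l. \<not> ?Q' l}"
    by auto
  have "finite {l. \<not> ?Q l} \<longleftrightarrow> finite {l. \<not> ?Q' l}"
    unfolding * by (rule finite_vimage_iff[OF f])
  then show ?case
    unfolding form.map act.map_ident sat_DiaAct by simp
next
  case (Conj h)
  then have "sat (ren_conf f C) (ren_form f \<phi>) \<longleftrightarrow> sat C \<phi>"
    if "\<phi> \<in> ran h" for \<phi>
    using that by (blast elim: ranE)
  then show ?case by (auto simp: o_def)
next
  case (EqCo v w)
  then show ?case by (cases v; cases w) (simp_all add: co_eq_ren[OF f])
qed auto

section \<open>Names of configurations along weak transitions\<close>

lemma hasco_subset_htrn: "hasco H \<subseteq> htrn H"
  by (force simp: hasco_def htrn_def ran_def)

lemma hname_mark: "(\<And>k. hname (c k) = k) \<Longrightarrow> hname (mark c E k h) = hname h"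
  by (cases h) (auto simp: mark_def)

lemma htrn_mark: "htrn (mark_co E k H) = htrn H" "htrn (mark_ab E k H) = htrn H"
  by (simp_all add: htrn_def mark_co_def mark_ab_def image_image hname_mark)

lemma htrn_upd: "H i = None \<Longrightarrow> htrn (H(i \<mapsto> h)) = insert (hname h) (htrn H)"
  by (simp add: htrn_def ran_map_upd)

text \<open>A variant of \<open>names_elab\<close> with values in the external names themselves, as
  for \<open>htrn\<close>.\<close>

primrec elab_names :: "('n, 'e) elab \<Rightarrow> 'e set" where
  "elab_names ETau = {}"
| "elab_names (EAct k a) = {k}"

text \<open>Commits and aborts change the kind of an entry but not its name; an action adds one
  entry, whose name the rules require to be fresh.\<close>

lemma htrn_etrans:
  assumes "etrans C \<zeta> C'"
  shows "htrn (hist C') = elab_names \<zeta>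
    \<union> htrn (hist C)" "elab_names \<zeta> \<inter> htrn (hist C) = {}"
proof -
  have "etrans_rule C \<zeta> C'"
    using assms by (simp add: etrans_def)
  then have "htrn (hist C') = elab_names \<zeta>
    \<union> htrn (hist C) \<and> elab_names \<zeta> \<inter> htrn (hist C) = {}"
    by cases (simp_all add: htrn_mark htrn_upd names_env_def domIff image_iff)
  then show "htrn (hist C') = elab_names \<zeta>
    \<union> htrn (hist C)" "elab_names \<zeta> \<inter> htrn (hist C) = {}"
    by auto
qed

lemma htrn_weak_tau: "weak_tau C C' \<Longrightarrow> htrn (hist C') = htrn (hist C)"
  by (induction rule: rtranclp_induct) (simp_all add: htrn_etrans)

lemma htrn_weak:
  assumes "weak C \<zeta> C'"
  shows "htrn (hist C') = elab_names \<zeta>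
    \<union> htrn (hist C)" "elab_names \<zeta> \<inter> htrn (hist C) = {}"
proof -
  have "htrn (hist C') = elab_names \<zeta>
    \<union> htrn (hist C) \<and> elab_names \<zeta> \<inter> htrn (hist C) = {}"
  proof (cases \<zeta>)
    case ETau
    then show ?thesis using assms htrn_weak_tau by (simp add: weak_def)
  next
    case (EAct l a)
    then obtain D D' where "weak_tau C D" "etrans D \<zeta> D'" "weak_tau D' C'"
      using assms by (auto simp: weak_def)
    then show ?thesis
      using htrn_etrans[of D \<zeta> D'] by (simp add: htrn_weak_tau)
  qed
  then show "htrn (hist C') = elab_names \<zeta>
    \<union> htrn (hist C)" "elab_names \<zeta> \<inter> htrn (hist C) = {}"
    by auto
qed

lemma config_weak:
  assumes "weak C \<zeta> C'" "config C"
  shows "config C'"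
proof -
  have tau: "config D'" if "weak_tau D D'" "config D" for D D' :: "('a, 'b, 'c) conf"
    using that by (induction rule: rtranclp_induct) (auto simp: etrans_def)
  show ?thesis
  proof (cases \<zeta>)
    case ETau
    then show ?thesis using assms tau by (simp add: weak_def)
  next
    case (EAct l a)
    then obtain D D' where "etrans D \<zeta> D'" "weak_tau D' C'"
      using assms by (auto simp: weak_def)
    moreover from this(1) have "config D'"
      by (simp add: etrans_def)
    ultimately show ?thesis using tau by blast
  qed
qed

lemma finite_htrn: "config C \<Longrightarrow> finite (htrn (hist C))"
  using config_ConfD(3)[of "eqv C" "hist C" "prc C"] by (simp add: htrn_def finite_ran)

text \<open>This reduces the freshness condition in bisimulations to the finite set of recorded
  names.\<close>

lemma Ex_in_names_conf_iff:
  assumes "config C"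
  shows "Ex k \<in> names_conf C \<longleftrightarrow> k \<in> htrn (hist C)"
proof (cases C)
  case (Conf E H P)
  note C' = config_ConfD[OF assms[unfolded Conf]]
  obtain A where A: "equiv A E"
    using C'(2) by blast
  have "k \<in> htrn H" if "Ex k \<in> Field E"
  proof -
    have "(Ex k, Ex k) \<in> E"
      using that A unfolding equiv_def refl_on_def Field_def by blast
    then show ?thesis using C'(5) by simp
  qed
  moreover have "k \<in> htrn H" if "Ex k \<in> ftn P"
    using that C'(9) by blast
  ultimately show ?thesis
    by (auto simp: Conf names_conf_def names_env_def)
qed

section \<open>Bisimilarity and logical equivalence\<close>

text \<open>Matching steps lead to related configurations, to which the induction hypothesis
  applies. For actions, matching is guaranteed for names fresh for both sides.\<close>

lemma sat_iff_if_bisimulation: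
  fixes C D :: "('n, 'm, 'e::infinite) conf"
  assumes R: "Eq_bisimulation R"
  shows "R C D \<Longrightarrow> free_vars \<phi> = {} \<Longrightarrow> sat C \<phi> \<longleftrightarrow> sat D \<phi>"
proof (induction \<phi> arbitrary: C D rule: form_subst_induct)
  case (Dia \<phi>)
  have *: "names_elab ETau \<inter> X = {}" for X :: "('m, 'e) trn set" by simp
  note sim = R[unfolded Eq_bisimulation_def, rule_format, OF Dia.prems(1)]
  have "\<exists>D'. weak D ETau D' \<and> R C' D'" if "weak C ETau C'" for C'
    using sim * that by blast
  moreover have "\<exists>C'. weak C ETau C' \<and> R C' D'" if "weak D ETau D'" for D'
    using sim * that by blast
  moreover have "sat C' \<phi> \<longleftrightarrow> sat D' \<phi>" if "R C' D'" for C' D'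
    using Dia.IH[OF that] Dia.prems(2) by simp
  ultimately show ?case
    unfolding sat.simps by blast
next
  case (DiaAct x a \<phi>)
  note sim = R[unfolded Eq_bisimulation_def, rule_format, OF DiaAct.prems(1)]
  have conf: "config C" "config D" using sim by auto
  have fv: "free_vars (fsubst l x \<phi>) = {}" for l
    using DiaAct.prems(2) by (auto simp: free_vars_fsubst)
  let ?S = "htrn (hist C) \<union> htrn (hist D)"
  let ?Q = "\<lambda>C l. \<exists>C'. weak C (EAct l a) C' \<and> sat C' (fsubst l x \<phi>)"
  have fin: "finite ?S"
    using conf finite_htrn by auto
  have "?Q C l \<longleftrightarrow> ?Q D l" if l: "l \<notin> ?S" for l
  proof -
    have fresh: "names_elab (EAct l a) \<inter> names_conf C = {}" "names_elab (EAct l a) \<inter> names_conf D = {}"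
      using l conf by (simp_all add: Ex_in_names_conf_iff)
    have "\<exists>D'. weak D (EAct l a) D' \<and> R C' D'" if "weak C (EAct l a) C'" for C'
      using sim fresh that by blast
    moreover have "\<exists>C'. weak C (EAct l a) C' \<and> R C' D'" if "weak D (EAct l a) D'" for D'
      using sim fresh that by blast
    moreover have "sat C' (fsubst l x \<phi>) \<longleftrightarrow> sat D' (fsubst l x \<phi>)"
      if "R C' D'" for C' D'
      using DiaAct.IH[OF that fv] .
    ultimately show ?thesis
      by blast
  qed
  \<comment> \<open>The two sets of failing names differ only within the finite set
    \<open>?S\<close>, so one is finite if and only if the other is.\<close>
  then have "{l. \<not> ?Q C l} \<subseteq> {l. \<not> ?Q D l}
    \<union> ?S" "{l. \<not> ?Q D l} \<subseteq> {l. \<not> ?Q C l} \<union> ?S"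
    by blast+
  then show ?case
    unfolding sat_DiaAct using fin by (meson finite_UnI finite_subset)
next
  case (Neg \<phi>)
  then show ?case by simp
next
  case (Conj f)
  then have "sat C \<phi> \<longleftrightarrow> sat D \<phi>" if "\<phi> \<in> ran f" for \<phi>
    using that by (auto elim!: ranE intro!: Conj.IH simp: ranI)
  then show ?case by simp
next
  case (EqCo v w)
  have "Eq C D"
    using R EqCo(1) by (simp add: Eq_bisimulation_def)
  then show ?case
    using EqCo(2) by (cases v; cases w) (auto simp: Eq_def)
qed

text \<open>
  Keeping the names within the history makes a conjunction over all the derivatives of a configuration
  mention finitely many names. Keeping the bound variables at or above the number of recorded names
  \<open>n\<close> leaves the variable \<open>n\<close> free of capture when the name added by the next action is abstracted.
\<close>

definition logic_eq ::
  "'i itself \<Rightarrow> ('n, 'm, 'e) conf \<Rightarrow> ('n, 'm, 'e) conf \<Rightarrow> bool" where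
  "logic_eq _ C D \<longleftrightarrow> config C \<and> config D \<and> htrn (hist C) = htrn (hist D) \<and>
     (\<forall>\<phi> :: ('n, 'e, 'i) form. free_vars \<phi> = {} \<longrightarrow> names_form \<phi> \<subseteq> htrn (hist C) \<longrightarrow>
        bvars \<phi> \<subseteq> {card (htrn (hist C))..} \<longrightarrow> (sat C \<phi> \<longleftrightarrow> sat D \<phi>))"

lemma logic_eq_sym: "logic_eq i C D \<Longrightarrow> logic_eq i D C"
  by (simp add: logic_eq_def)

lemma logic_eqD:
  fixes \<phi> :: "('n, 'e, 'i) form"
  assumes "logic_eq TYPE('i) C D" "free_vars \<phi> = {}" "names_form \<phi> \<subseteq> htrn (hist C)"
    "bvars \<phi> \<subseteq> {card (htrn (hist C))..}" "sat C \<phi>"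
  shows "sat D \<phi>"
  using assms unfolding logic_eq_def by blast

text \<open>One separating formula is chosen for each member of \<open>X\<close>. All of them use
  only names recorded in \<open>C\<close>, and hence so does their conjunction, however large
  \<open>X\<close> is.\<close>

lemma distinguishing_formula:
  fixes C :: "('n, 'm, 'e) conf" and idx :: "('n, 'm, 'e) conf \<Rightarrow> 'i"
  assumes idx: "inj idx" and C: "config C"
    and X: "\<And>D. D \<in> X \<Longrightarrow> config D \<and> htrn (hist D) = htrn (hist C) \<and> \<not> logic_eq TYPE('i) C D"
  obtains \<phi> :: "('n, 'e, 'i) form"
    where "free_vars \<phi> = {}" "names_form \<phi> \<subseteq> htrn (hist C)"
    "bvars \<phi> \<subseteq> {card (htrn (hist C))..}" "sat C \<phi>" "\<And>D. D \<in> X \<Longrightarrow> \<not> sat D \<phi>"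
proof -
  define good :: "('n, 'e, 'i) form \<Rightarrow> bool" where
    "good \<phi>
      \<longleftrightarrow> free_vars \<phi> = {} \<and> names_form \<phi> \<subseteq> htrn (hist C) \<and>
      bvars \<phi> \<subseteq> {card (htrn (hist C))..} \<and> sat C \<phi>" for \<phi>
  have "\<exists>\<phi>. good \<phi> \<and> \<not> sat D \<phi>" if D: "D \<in> X" for D
  proof -
    obtain \<phi> :: "('n, 'e, 'i) form"
      where \<phi>: "free_vars \<phi> = {}" "names_form \<phi> \<subseteq> htrn (hist C)"
      "bvars \<phi> \<subseteq> {card (htrn (hist C))..}" "sat C \<phi> \<noteq> sat D \<phi>"
      using X[OF D] C unfolding logic_eq_def by metis
    show ?thesis
    \<comment> \<open>The formula has to hold in \<open>C\<close>, so it is negated if it holds in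
      \<open>D\<close> instead.\<close>
    proof (cases "sat C \<phi>")
      case True
      then show ?thesis
        using \<phi> by (intro exI[of _ \<phi>]) (simp add: good_def)
    next
      case False
      then show ?thesis
        using \<phi> by (intro exI[of _ "Neg \<phi>"]) (simp add: good_def)
    qed
  qed
  then obtain F
    where F: "\<And>D. D \<in> X \<Longrightarrow> good (F D)" "\<And>D. D \<in> X \<Longrightarrow> \<not> sat D (F D)"
    by metis
  \<comment> \<open>The members of \<open>X\<close> themselves index the conjunction, through the
    injection \<open>idx\<close> into the index type.\<close>
  define h where "h i = (if i \<in> idx ` X then Some (F (inv idx i)) else None)" for i
  have ran_h: "ran h = F ` X"
  proof
    show "ran h \<subseteq> F ` X"
      using inv_f_f[OF idx] by (auto simp: ran_def h_def split: if_splits)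
    have "h (idx D) = Some (F D)" if "D \<in> X" for D
      using that inv_f_f[OF idx] by (simp add: h_def)
    then show "F ` X \<subseteq> ran h"
      by (auto intro: ranI)
  qed
  show thesis
  proof (rule that[of "Conj h"])
    show "free_vars (Conj h) = {}" "names_form (Conj h) \<subseteq> htrn (hist C)"
      "bvars (Conj h) \<subseteq> {card (htrn (hist C))..}" "sat C (Conj h)"
      unfolding free_vars_Conj names_form_Conj bvars_Conj sat.simps ran_h
      using F(1) unfolding good_def by blast+
    show "\<not> sat D (Conj h)" if "D \<in> X" for D
      using F(2)[OF that] that by (auto simp: ran_h)
  qed
qed

text \<open>Both histories record the same names, so a name fresh for \<open>C\<close> is fresh for
  \<open>D\<close>.\<close>

lemma logic_eq_simulates:
  fixes C D :: "('n, 'm, 'e::infinite) conf" and idx :: "('n, 'm, 'e) conf \<Rightarrow> 'i"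
  assumes idx: "inj idx" and CD: "logic_eq TYPE('i) C D" and step: "weak C \<zeta> C'"
  shows "\<exists>D'. weak D \<zeta> D' \<and> logic_eq TYPE('i) C' D'"
proof (rule ccontr)
  assume neg: "\<not> ?thesis"
  let ?S = "htrn (hist C)"
  have conf: "config C" "config D" and htrn_D: "htrn (hist D) = ?S"
    using CD by (auto simp: logic_eq_def)
  have C': "config C'" "htrn (hist C') = elab_names \<zeta> \<union> ?S" "elab_names \<zeta> \<inter> ?S = {}"
    using config_weak[OF step conf(1)] htrn_weak[OF step] by auto
  \<comment> \<open>A weak step adds just the names of its label to the history, so every derivative
    of \<open>D\<close> records the same names as \<open>C'\<close>. By assumption none is logically
    equivalent to it.\<close>
  have *: "config D' \<and> htrn (hist D') = htrn (hist C') \<and> \<not> logic_eq TYPE('i) C' D'"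
    if "D' \<in> {D'. weak D \<zeta> D'}" for D'
    using that neg config_weak[OF _ conf(2)] htrn_weak(1)[of D \<zeta> D'] C'(2) htrn_D by auto
  obtain \<phi> :: "('n, 'e, 'i) form" where
    \<phi>: "free_vars \<phi> = {}" "names_form \<phi> \<subseteq> htrn (hist C')" "bvars \<phi> \<subseteq> {card (htrn (hist C'))..}"
    and sat_C': "sat C' \<phi>"
      and not_sat: "\<And>D'. weak D \<zeta> D' \<Longrightarrow> \<not> sat D' \<phi>"
    using distinguishing_formula[OF idx C'(1) *] by (metis mem_Collect_eq)
  show False
  proof (cases \<zeta>)
    case ETau
    have "sat C (Dia \<phi>)"
      using step sat_C' ETau by auto
    then have "sat D (Dia \<phi>)"
      using \<phi> C' ETau by (intro logic_eqD[OF CD]) auto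
    then show False
      using not_sat ETau by auto
  next
    case (EAct l a)
    \<comment> \<open>The variable to be bound by the new modality. \<open>C'\<close> records one
      name more than \<open>C\<close>, so the binders of \<open>\<phi>\<close> start at
      \<open>Suc n\<close> and cannot capture \<open>n\<close>, while those of \<open>\<chi>\<close>
      start at \<open>n\<close>, as required for \<open>C\<close>.\<close>
    define n where "n = card ?S"
    define \<chi> where "\<chi> = DiaAct n a (abstract_name l n \<phi>)"
    have l: "l \<notin> ?S" and names: "names_form \<phi> - {l} \<subseteq> ?S"
      using C' \<phi>(2) EAct by auto
    have "card (htrn (hist C')) = Suc n"
      using C'(2) l EAct finite_htrn[OF conf(1)] by (simp add: n_def)
    then have bv: "bvars \<phi> \<subseteq> {Suc n..}"
      using \<phi>(3) by simp
    then have n: "n \<notin> bvars \<phi>"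
      by auto
    have inst: "fsubst l' n (abstract_name l n \<phi>) = ren_form (transpose l l') \<phi>"
      if "l' \<notin> ?S" for l'
      using fsubst_abstract_name[OF n, of l' l] \<phi>(1) names that by auto
    \<comment> \<open>Neither \<open>l\<close> nor \<open>l'\<close> is recorded in
      \<open>B\<close>, so the transposition fixes \<open>B\<close> and changes only the label and
      the derivative.\<close>
    have swap: "weak B (EAct (transpose l l' k) a) (ren_conf (transpose l l') B')"
      if "weak B (EAct k a) B'" "config B" "htrn (hist B) = ?S" "l' \<notin> ?S" for B B' l' k
    proof -
      have "ren_conf (transpose l l') B = B"
        using that l by (intro ren_conf_ident) (auto simp: transpose_def)
      then show ?thesis
        using weak_ren[OF that(1), of "transpose l l'"] by (simp add: act.map_ident)
    qed
    \<comment> \<open>The given step to \<open>C'\<close>, transposed, serves as a witness for every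
      unrecorded \<open>l'\<close>.\<close>
    have "\<exists>B. weak C (EAct l' a) B \<and> sat B (fsubst l' n (abstract_name l n \<phi>))"
      if "l' \<notin> ?S" for l'
      using swap[OF step[unfolded EAct] conf(1) refl that] sat_C' sat_ren[of "transpose l l'" C' \<phi>]
      by (auto simp: inst[OF that])
    then have "{l'. \<nexists>B. weak C (EAct l' a) B \<and> sat B (fsubst l' n (abstract_name l n \<phi>))} \<subseteq> ?S"
      by blast
    then have "sat C \<chi>"
      unfolding \<chi>_def sat_DiaAct using finite_htrn[OF conf(1)] by (rule finite_subset)
    moreover have "free_vars \<chi> = {}" "names_form \<chi> \<subseteq> ?S" "bvars \<chi> \<subseteq> {n..}"
      using free_vars_abstract_name[of l n \<phi>] \<phi>(1) names bv
      by (auto simp: \<chi>_def names_form_abstract_name bvars_abstract_name)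
    ultimately have "sat D \<chi>"
      using logic_eqD[OF CD] by (simp add: n_def)
    \<comment> \<open>As there are infinitely many external names, some \<open>l'\<close> is both
      unrecorded and successful for \<open>D\<close>.\<close>
    then have "finite ({l'. \<nexists>B. weak D (EAct l' a) B \<and> sat B (fsubst l' n (abstract_name l n \<phi>))} \<union> ?S)"
      unfolding \<chi>_def sat_DiaAct using finite_htrn[OF conf(1)] by simp
    then obtain l'
      where "l' \<notin> {l'. \<nexists>B. weak D (EAct l' a) B \<and> sat B (fsubst l' n (abstract_name l n \<phi>))} \<union> ?S"
      using ex_new_if_finite[OF infinite_UNIV] by blast
    then obtain B where l': "l' \<notin> ?S"
      and B: "weak D (EAct l' a) B" "sat B (ren_form (transpose l l') \<phi>)"
      using inst by auto
    \<comment> \<open>Transposing once more returns from \<open>l'\<close> to the original label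
      \<open>l\<close>, giving a derivative of \<open>D\<close> that satisfies
      \<open>\<phi>\<close>.\<close>
    have "weak D (EAct l a) (ren_conf (transpose l l') B)"
      using swap[OF B(1) conf(2) htrn_D l'] by simp
    moreover have "sat (ren_conf (transpose l l') B) \<phi>"
      using B(2) sat_ren[of "transpose l l'" "ren_conf (transpose l l') B" \<phi>]
      by (simp add: ren_conf_comp ren_conf_id o_def)
    ultimately show False
      using not_sat EAct by blast
  qed
qed

text \<open>Committed names are recorded, so the atomic formula about two of them is among those
  that \<open>logic_eq\<close> compares.\<close>

lemma Eq_if_logic_eq:
  fixes C D :: "('n, 'm, 'e) conf"
  assumes "logic_eq TYPE('i) C D"
  shows "Eq C D"
proof -
  have le: "co_eq D k k'" if "logic_eq TYPE('i) C D" "co_eq C k k'"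
    for C D :: "('n, 'm, 'e) conf" and k k'
  proof -
    have "sat D (EqCo (Inl k) (Inl k') :: ('n, 'e, 'i) form)"
      using that(2) hasco_subset_htrn[of "hist C"]
      by (intro logic_eqD[OF that(1)]) (auto simp: co_eq_def setl.simps)
    then show ?thesis by simp
  qed
  show ?thesis
    unfolding Eq_def using le[OF assms] le[OF logic_eq_sym[OF assms]] by (intro allI iffI)
qed

lemma Eq_bisimulation_logic_eq:
  fixes idx :: "('n, 'm, 'e::infinite) conf \<Rightarrow> 'i"
  assumes "inj idx"
  shows "Eq_bisimulation (logic_eq TYPE('i) :: ('n, 'm, 'e) conf \<Rightarrow> _)"
  unfolding Eq_bisimulation_def
proof (intro allI impI conjI)
  fix C D :: "('n, 'm, 'e) conf" and \<zeta> B
  assume CD: "logic_eq TYPE('i) C D"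
  then show "config C" "config D"
    by (simp_all add: logic_eq_def)
  show "Eq C D"
    by (rule Eq_if_logic_eq[OF CD])
  show "\<exists>D'. weak D \<zeta> D' \<and> logic_eq TYPE('i) B D'" if "weak C \<zeta> B"
    using logic_eq_simulates[OF assms CD that] .
  show "\<exists>C'. weak C \<zeta> C' \<and> logic_eq TYPE('i) C' B" if "weak D \<zeta> B"
    using logic_eq_simulates[OF assms logic_eq_sym[OF CD] that] logic_eq_sym by blast
qed

lemma config_init:
  assumes "process P" "ftn P \<subseteq> range In"
  shows "config (init P)"
proof -
  have "equiv {} {}"
    by (simp add: equiv_def refl_on_def)
  then show ?thesis
    using assms by (auto simp: config_def init_def htrn_def hasco_def)
qed

theorem proposition4p10:
  fixes P Q :: "('n::infinite, ('m::infinite, 'e::infinite) trn) tm"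
    and idx :: "('n, 'm, 'e) conf \<Rightarrow> 'i"
  assumes "inj idx"
    and "process P" and "ftn P \<subseteq> range In"
    and "process Q" and "ftn Q \<subseteq> range In"
  shows "P \<approx>\<^sub>E\<^sub>q Q \<longleftrightarrow> (L_Eq P :: ('n, 'e, 'i) form set) = L_Eq Q"
proof
  assume "P \<approx>\<^sub>E\<^sub>q Q"
  then obtain R where "Eq_bisimulation R" "R (init P) (init Q)"
    unfolding bisim_def conf_bisim_def by blast
  then show "(L_Eq P :: ('n, 'e, 'i) form set) = L_Eq Q"
    unfolding L_Eq_def using sat_iff_if_bisimulation by blast
next
  assume "(L_Eq P :: ('n, 'e, 'i) form set) = L_Eq Q"
  then have "sat (init P) \<phi> \<longleftrightarrow> sat (init Q) \<phi>"
    if "free_vars \<phi> = {}" for \<phi> :: "('n, 'e, 'i) form"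
    using that unfolding L_Eq_def by blast
  \<comment> \<open>Both initial histories are empty, so they record the same names, and every
    formula that \<open>logic_eq\<close> compares is a closed one to which the hypothesis
    applies.\<close>
  then have "logic_eq TYPE('i) (init P) (init Q)"
    using assms config_init unfolding logic_eq_def by (auto simp: init_def)
  then show "P \<approx>\<^sub>E\<^sub>q Q"
    using Eq_bisimulation_logic_eq[OF assms(1)] unfolding bisim_def conf_bisim_def by blast
qed

end
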